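(* Let $U\in\mathbb C^{n\times n}$ be a unitary matrix, $U_H=\frac{U+U^H}{2}$, and let $\mathbf z\in\mathbb C^n$. Apply the algorithm Block_Lanczos to $U_H$ with the initial vectors $D_0=[\mathbf z\,|\,U\mathbf z]$, and assume that the set of vectors $U_H^{j-1}\mathbf z,\ U_H^{j-1}U\mathbf z$, $j\ge1$, yields a basis of the whole space $\mathbb C^n$ (i.e. these vectors span $\mathbb C^n$). Let $Q\in\mathbb C^{n\times n}$ be the unitary matrix produced by the algorithm, and let $$T=Q^HUQ=\begin{bmatrix}\hat A_1&\tilde B_1^H&&\\ \hat B_1&\hat A_2&\ddots&\\ &\ddots&\ddots&\tilde B_{p-1}^H\\ &&\hat B_{p-1}&\hat A_p\end{bmatrix}$$ be the resulting block tridiagonal matrix, whose diagonal blocks are all $2\times2$, except that $\hat A_p$ is $1\times1$ when $n$ is odd. Then all the subdiagonal blocks $\hat B_k$ and all the superdiagonal blocks $\tilde B_k^H$, $1\le k\le p-1$, are rank-one matrices of size $2\times2$ (except that, when $n$ is odd, $\hat B_{p-1}$ has size $1\times2$ and $\tilde B_{p-1}^H$ has size $2\times1$).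
   Context: $M^H$ denotes the conjugate transpose of $M$. The algorithm Block_Lanczos (in exact arithmetic), with inputs the Hermitian matrix $U_H\in\mathbb C^{n\times n}$ and $D_0\in\mathbb C^{n\times 2}$, is the following. Compute a singular value decomposition $D_0=GRV^H$, set $i_1=\operatorname{rank}(D_0)$ and $Q_1=G(:,1:i_1)$ (an orthonormal basis of the column space of $D_0$). For $j=1,2,\dots$, as long as $i_1+\dots+i_j<n$: set $A_j=Q_j^HU_HQ_j$ and $$W_j=U_HQ_j-Q_jA_j-Q_{j-1}B_{j-1}^H$$ (the last term is omitted for $j=1$); compute a singular value decomposition $W_j=GRV^H$ and set $i_{j+1}=\operatorname{rank}(W_j)$; if $i_{j+1}=0$ the algorithm stops with an early (premature) termination warning; otherwise set $Q_{j+1}=G(:,1:i_{j+1})$ and $B_j=R(1:i_{j+1},1:i_{j+1})\,V(:,1:i_{j+1})^H\in\mathbb C^{i_{j+1}\times i_j}$, so that $W_j=Q_{j+1}B_j$. When $i_1+\dots+i_p=n$ for some $p$ the algorithm sets $A_p=Q_p^HU_HQ_p$ and terminates without early termination, returning the unitary matrix $Q=[Q_1\,|\,\cdots\,|\,Q_p]\in\mathbb C^{n\times n}$. Under the stated hypotheses it is known that $Q^HUQ$ is block tridiagonal with respect to the partitioning with block sizes $i_1=\dots=i_{p-1}=2$ and $i_p=2$ ($n$ even) or $i_p=1$ ($n$ odd). *)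

theory Defs
  imports
    Complex_Main
    "Jordan_Normal_Form.Schur_Decomposition"
    "Jordan_Normal_Form.DL_Rank"
    "Jordan_Normal_Form.DL_Submatrix"
begin

abbreviation mat_rank :: "complex mat \<Rightarrow> nat"
  where "mat_rank A \<equiv> vec_space.rank (dim_row A) A"

abbreviation vec_span :: "nat \<Rightarrow> complex vec set \<Rightarrow> complex vec set"
  where "vec_span n S \<equiv> LinearCombinations.module.span class_ring (module_vec TYPE(complex) n) S"

definition unitary_mat :: "nat \<Rightarrow> complex mat \<Rightarrow> bool"
  where "unitary_mat n A \<longleftrightarrow>
    A \<in> carrier_mat n n \<and> mat_adjoint A * A = 1\<^sub>m n \<and> A * mat_adjoint A = 1\<^sub>m n"

definition hermitian_part :: "complex mat \<Rightarrow> complex mat"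
  where "hermitian_part A = (1 / 2) \<cdot>\<^sub>m (A + mat_adjoint A)"

definition is_svd :: "complex mat \<Rightarrow> complex mat \<Rightarrow> complex mat \<Rightarrow> complex mat \<Rightarrow> bool"
  where "is_svd A G R V \<longleftrightarrow>
    unitary_mat (dim_row A) G \<and> unitary_mat (dim_col A) V \<and>
    (\<exists>\<sigma> :: nat \<Rightarrow> real.
       (\<forall>i. 0 \<le> \<sigma> i) \<and> antimono_on {..<min (dim_row A) (dim_col A)} \<sigma> \<and>
       R = mat (dim_row A) (dim_col A) (\<lambda>(i, j). if i = j then complex_of_real (\<sigma> i) else 0)) \<and>
    A = G * R * mat_adjoint V"

definition first_cols :: "nat \<Rightarrow> complex mat \<Rightarrow> complex mat"
  where "first_cols r A = submatrix A UNIV {..<r}"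

definition leading_block :: "nat \<Rightarrow> complex mat \<Rightarrow> complex mat"
  where "leading_block r A = submatrix A {..<r} {..<r}"

text \<open>
  The matrix \<open>W\<^sub>j\<close>, where \<open>Qs = [Q\<^sub>1, \<dots>, Q\<^sub>j]\<close> and \<open>Bs = [B\<^sub>1, \<dots>, B\<^sub>j\<^sub>-\<^sub>1]\<close>; the product in the
  let binding is \<open>A\<^sub>j\<close>.
\<close>

definition lanczos_residual :: "complex mat \<Rightarrow> complex mat list \<Rightarrow> complex mat list \<Rightarrow> complex mat"
  where "lanczos_residual H Qs Bs =
    (let j = length Qs; Q = last Qs; A = mat_adjoint Q * H * Q; W = H * Q - Q * A
     in if j = 1 then W else W - Qs ! (j - 2) * mat_adjoint (last Bs))"

text \<open>
  A singular value decomposition is not unique, so the algorithm is modelled as a relation that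
  allows every choice of it. The block size \<open>i\<^sub>j\<close> is the number of columns of \<open>Q\<^sub>j\<close>.
\<close>

inductive lanczos_state ::
  "nat \<Rightarrow> complex mat \<Rightarrow> complex mat \<Rightarrow> complex mat list \<Rightarrow> complex mat list \<Rightarrow> bool"
  for n :: nat and H D0 :: "complex mat"
  where
    start: "is_svd D0 G R V \<Longrightarrow> lanczos_state n H D0 [first_cols (mat_rank D0) G] []"
  | step: "lanczos_state n H D0 Qs Bs \<Longrightarrow> sum_list (map dim_col Qs) < n \<Longrightarrow>
      W = lanczos_residual H Qs Bs \<Longrightarrow> is_svd W G R V \<Longrightarrow> r = mat_rank W \<Longrightarrow> r \<noteq> 0 \<Longrightarrow>
      lanczos_state n H D0 (Qs @ [first_cols r G])
        (Bs @ [leading_block r R * mat_adjoint (first_cols r V)])"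

datatype lanczos_outcome = Returned "complex mat list" | Early_Termination

inductive block_lanczos ::
  "nat \<Rightarrow> complex mat \<Rightarrow> complex mat \<Rightarrow> lanczos_outcome \<Rightarrow> bool"
  for n :: nat and H D0 :: "complex mat"
  where
    returned: "lanczos_state n H D0 Qs Bs \<Longrightarrow> sum_list (map dim_col Qs) = n \<Longrightarrow>
      block_lanczos n H D0 (Returned Qs)"
  | early: "lanczos_state n H D0 Qs Bs \<Longrightarrow> sum_list (map dim_col Qs) < n \<Longrightarrow>
      mat_rank (lanczos_residual H Qs Bs) = 0 \<Longrightarrow> block_lanczos n H D0 Early_Termination"

definition concat_cols :: "nat \<Rightarrow> complex mat list \<Rightarrow> complex mat"
  where "concat_cols n Qs = mat_of_cols n (concat (map cols Qs))"

text \<open>Blocks are numbered from 1, whereas the rows and columns of a matrix are numbered from 0.\<close>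

definition block_range :: "nat list \<Rightarrow> nat \<Rightarrow> nat set"
  where "block_range sz i = {sum_list (take (i - 1) sz)..<sum_list (take i sz)}"

definition mat_block :: "nat list \<Rightarrow> complex mat \<Rightarrow> nat \<Rightarrow> nat \<Rightarrow> complex mat"
  where "mat_block sz T i j = submatrix T (block_range sz i) (block_range sz j)"

definition block_tridiagonal :: "nat list \<Rightarrow> complex mat \<Rightarrow> bool"
  where "block_tridiagonal sz T \<longleftrightarrow>
    T \<in> carrier_mat (sum_list sz) (sum_list sz) \<and>
    (\<forall>i\<in>{1..length sz}. \<forall>j\<in>{1..length sz}. i + 1 < j \<or> j + 1 < i \<longrightarrow>
       mat_block sz T i j = 0\<^sub>m (sz ! (i - 1)) (sz ! (j - 1)))"

end

theory Submission
  imports Defs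
begin

text \<open>
  Put \<open>u\<^sub>k = U\<^sup>k z\<close> for every integer \<open>k\<close>. Since \<open>U\<close> is unitary, \<open>2 U\<^sub>H = U + U\<^sup>-\<^sup>1\<close>, so \<open>2 U\<^sub>H u\<^sub>k =
  u\<^sub>k\<^sub>+\<^sub>1 + u\<^sub>k\<^sub>-\<^sub>1\<close>: each application of \<open>U\<^sub>H\<close> to the window \<open>u\<^sub>1\<^sub>-\<^sub>k, \<dots>, u\<^sub>k\<close> lengthens it by one vector
  at each end. Started from \<open>z = u\<^sub>0\<close> and \<open>U z = u\<^sub>1\<close>, the block Lanczos process therefore has the
  span of this window as its \<open>k\<close>-th Krylov subspace \<open>K\<^sub>k\<close>, which is the span of the columns of
  \<open>Q\<^sub>1, \<dots>, Q\<^sub>k\<close> (\<open>lanczos_prefix_span\<close>).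

  If a vector of the orbit depends linearly on the \<open>l\<close> vectors just before it, the span of those is
  invariant under \<open>U\<close>, and then also under the inverse of \<open>U\<close> because the dimension is finite. It
  contains the whole orbit, hence is the whole space. So \<open>l\<close> consecutive orbit vectors span a space
  of dimension \<open>min l n\<close> (\<open>window_dim\<close>), and \<open>K\<^sub>k\<close> has dimension \<open>min (2 k) n\<close>. This gives the
  block sizes; it also excludes an early termination, since a vanishing residual makes some proper
  \<open>K\<^sub>k\<close> invariant (\<open>no_early_termination\<close>).

  The block structure of \<open>T\<close> now comes from counting. \<open>U\<close> shifts the window of \<open>K\<^sub>k\<close> by one place:
  \<open>U K\<^sub>k\<close> lies in \<open>K\<^sub>k\<close> plus the line through \<open>u\<^sub>k\<^sub>+\<^sub>1\<close>. Consequently \<open>Q\<^sub>i\<^sup>H U Q\<^sub>k = 0\<close> for \<open>i > k + 1\<close>, while all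
  columns of \<open>Q\<^sub>k\<^sub>+\<^sub>1\<^sup>H U Q\<^sub>k\<close> are multiples of the single vector \<open>Q\<^sub>k\<^sub>+\<^sub>1\<^sup>H u\<^sub>k\<^sub>+\<^sub>1\<close>, so that its rank is at
  most one. It is not zero, because otherwise \<open>K\<^sub>k\<close> would be invariant (\<open>subdiagonal_rank_one\<close>).
  The window is symmetric under \<open>k \<mapsto> 1 - k\<close>, which turns the orbit of \<open>U\<close> into an orbit of
  \<open>U\<^sup>H\<close>; applying the same argument to \<open>U\<^sup>H\<close> and taking adjoints settles the blocks above the
  diagonal (\<open>reversed_blocks\<close>).
\<close>

section \<open>Adjoints of complex matrices\<close>

text \<open>
  Two simplification rules compete for the columns of a product. Only the one that produces a
  matrix-vector product is kept, since column spaces are handled through such products.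
\<close>

declare col_mult [simp del]

lemma mat_adjoint_dim [simp]:
  "dim_row (mat_adjoint A) = dim_col A" "dim_col (mat_adjoint A) = dim_row A"
  by (auto simp: mat_adjoint_def)

lemma mat_adjoint_carrier [simp, intro]:
  "A \<in> carrier_mat m k \<Longrightarrow> mat_adjoint A \<in> carrier_mat k m"
  by (auto intro!: carrier_matI)

lemma mat_adjoint_index [simp]:
  "i < dim_col A \<Longrightarrow> j < dim_row A \<Longrightarrow> mat_adjoint A $$ (i, j) = conjugate (A $$ (j, i))"
  by (simp add: mat_adjoint_def mat_of_rows_index col_def)

lemma mat_adjoint_adjoint [simp]: "mat_adjoint (mat_adjoint A) = (A :: complex mat)"
  by (rule eq_matI) auto

lemma mat_adjoint_mult:
  fixes A B :: "complex mat"
  assumes "dim_col A = dim_row B"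
  shows "mat_adjoint (A * B) = mat_adjoint B * mat_adjoint A"
  by (rule eq_matI) (use assms in \<open>auto simp: scalar_prod_def intro!: sum.cong\<close>)

lemma mat_adjoint_zero [simp]: "mat_adjoint (0\<^sub>m m k :: complex mat) = 0\<^sub>m k m"
  by (rule eq_matI) auto

lemma col_adjoint_mult:
  fixes A B :: "complex mat"
  assumes "A \<in> carrier_mat n k" "B \<in> carrier_mat n l" "j < l"
  shows "col (mat_adjoint A * B) j = mat_adjoint A *\<^sub>v col B j"
  using assms by (simp add: col_mult2[of _ k n _ l])

lemma col_adjoint_triple:
  fixes A B C :: "complex mat"
  assumes "A \<in> carrier_mat n k" "B \<in> carrier_mat n n" "C \<in> carrier_mat n l" "j < l"
  shows "col (mat_adjoint A * B * C) j = mat_adjoint A *\<^sub>v (B *\<^sub>v col C j)"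
proof -
  have "mat_adjoint A * B * C = mat_adjoint A * (B * C)"
    using assms by (intro assoc_mult_mat) auto
  thus ?thesis using assms by (simp add: col_mult2[of _ k n _ l] col_mult2[of _ n n _ l])
qed

lemma mat_adjoint_triple:
  fixes A B C :: "complex mat"
  assumes "A \<in> carrier_mat n k" "B \<in> carrier_mat n n" "C \<in> carrier_mat n l"
  shows "mat_adjoint (mat_adjoint A * B * C) = mat_adjoint C * mat_adjoint B * A"
proof -
  have "mat_adjoint (mat_adjoint A * B * C) = mat_adjoint C * (mat_adjoint B * A)"
    using assms by (simp add: mat_adjoint_mult)
  thus ?thesis using assms by (simp add: assoc_mult_mat[of _ l n _ n _ k])
qed

lemma hermitian_adjoint_swap:
  fixes A B H :: "complex mat"
  assumes "A \<in> carrier_mat n k" "B \<in> carrier_mat n l" "H \<in> carrier_mat n n" "mat_adjoint H = H"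
  shows "mat_adjoint (mat_adjoint A * (H * B)) = mat_adjoint B * (H * A)"
  using assms by (simp add: mat_adjoint_mult assoc_mult_mat[of _ l n _ n _ k])

text \<open>
  An entry of \<open>X\<^sup>H A Y\<close> involves only one column of \<open>X\<close> and one of \<open>Y\<close>; so the entries of
  \<open>Q\<^sup>H A Q\<close> for \<open>Q = [Q\<^sub>1 | \<dots> | Q\<^sub>p]\<close> are those of the products \<open>Q\<^sub>i\<^sup>H A Q\<^sub>j\<close>.
\<close>

lemma sandwich_index:
  fixes A X Y :: "complex mat"
  assumes "X \<in> carrier_mat n k" "A \<in> carrier_mat n n" "Y \<in> carrier_mat n l" "r < k" "s < l"
  shows "(mat_adjoint X * A * Y) $$ (r, s) = conjugate (col X r) \<bullet> (A *\<^sub>v col Y s)"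
proof -
  have "mat_adjoint X * A * Y = mat_adjoint X * (A * Y)"
    using assms by (intro assoc_mult_mat) auto
  moreover have "row (mat_adjoint X) r = conjugate (col X r)"
    using assms by (intro eq_vecI) auto
  ultimately show ?thesis using assms by (simp add: col_mult2)
qed

section \<open>Spans, independence and rank\<close>

lemma set_colsE:
  assumes "v \<in> set (cols A)"
  obtains j where "j < dim_col A" "v = col A j"
  using assms by (auto simp: cols_def)

lemma zero_matI:
  assumes "A \<in> carrier_mat m k" "\<And>j. j < k \<Longrightarrow> col A j = 0\<^sub>v m"
  shows "A = 0\<^sub>m m k"
proof (rule eq_matI)
  fix i j assume "i < dim_row (0\<^sub>m m k :: 'a mat)" "j < dim_col (0\<^sub>m m k :: 'a mat)"
  hence ij: "i < m" "j < k" by auto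
  hence "A $$ (i, j) = col A j $ i" using assms(1) by simp
  thus "A $$ (i, j) = 0\<^sub>m m k $$ (i, j)" using assms(2) ij by simp
qed (use assms in auto)

lemma diff_diff_mat:
  fixes A B C :: "'a :: ab_group_add mat"
  assumes "A \<in> carrier_mat n l" "B \<in> carrier_mat n l" "C \<in> carrier_mat n l"
  shows "A - B - C = A - (B + C)"
  using assms by (intro eq_matI) auto

lemma mat_unit_vec_col:
  assumes "M \<in> carrier_mat n k" "i < k"
  shows "M *\<^sub>v unit_vec k i = (col M i :: 'a :: semiring_1 vec)"
  using assms by (intro eq_vecI) auto

context
  fixes n :: nat
begin

interpretation vec_space "TYPE(complex)" n .

text \<open>
  The vectors with a property that is closed under linear combinations form a submodule, so membership
  in a span can be used through an induction rule that hides the linear combinations.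
\<close>

lemma vec_span_induct [consumes 2, case_names zero base add smult]:
  assumes v: "v \<in> vec_span n S" and S: "S \<subseteq> carrier_vec n"
    and zero: "P (0\<^sub>v n)" and base: "\<And>s. s \<in> S \<Longrightarrow> P s"
    and add: "\<And>v w. v \<in> carrier_vec n \<Longrightarrow> w \<in> carrier_vec n \<Longrightarrow> P v \<Longrightarrow> P w \<Longrightarrow> P (v + w)"
    and smult: "\<And>c v. v \<in> carrier_vec n \<Longrightarrow> P v \<Longrightarrow> P (c \<cdot>\<^sub>v v)"
  shows "P v"
proof -
  have "submodule class_ring {v \<in> carrier_vec n. P v} V"
    unfolding submodule_def using vec_module zero add smult by auto
  hence "span S \<subseteq> {v \<in> carrier_vec n. P v}"
    by (rule span_is_subset[rotated]) (use S base in auto)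
  thus ?thesis using v by auto
qed

lemma vec_span_carrier: "S \<subseteq> carrier_vec n \<Longrightarrow> v \<in> vec_span n S \<Longrightarrow> v \<in> carrier_vec n"
  by simp

lemma vec_span_zero: "0\<^sub>v n \<in> vec_span n S"
  using vectorspace.span_zero[OF vec_vs, of n S] by simp

lemma vec_span_base: "S \<subseteq> carrier_vec n \<Longrightarrow> s \<in> S \<Longrightarrow> s \<in> vec_span n S"
  by (simp add: span_mem)

lemma vec_span_add:
  "S \<subseteq> carrier_vec n \<Longrightarrow> v \<in> vec_span n S \<Longrightarrow> w \<in> vec_span n S \<Longrightarrow> v + w \<in> vec_span n S"
  by (simp add: span_add1)

lemma vec_span_smult: "S \<subseteq> carrier_vec n \<Longrightarrow> v \<in> vec_span n S \<Longrightarrow> c \<cdot>\<^sub>v v \<in> vec_span n S"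
  by (simp add: smult_in_span)

lemma vec_span_diff:
  assumes "S \<subseteq> carrier_vec n" "v \<in> vec_span n S" "w \<in> vec_span n S"
  shows "v - w \<in> vec_span n S"
proof -
  have "v - w = v + (-1) \<cdot>\<^sub>v w"
    using vec_span_carrier[OF assms(1)] assms(2,3) by (intro eq_vecI) auto
  thus ?thesis using assms vec_span_add vec_span_smult by metis
qed

lemma vec_span_minimal:
  assumes "T \<subseteq> carrier_vec n" "S \<subseteq> vec_span n T"
  shows "vec_span n S \<subseteq> vec_span n T"
  using assms by (rule span_subsetI)

lemma vec_span_mono:
  assumes "T \<subseteq> carrier_vec n" "S \<subseteq> T"
  shows "vec_span n S \<subseteq> vec_span n T"
  using assms by (simp add: span_is_monotone)

lemma vec_span_cols:
  assumes "M \<in> carrier_mat n k"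
  shows "vec_span n (set (cols M)) = {M *\<^sub>v x | x. x \<in> carrier_vec k}"
  using col_space_eq[OF assms] assms unfolding col_space_def by auto

lemma set_cols_carrier: "M \<in> carrier_mat n k \<Longrightarrow> set (cols M) \<subseteq> carrier_vec n"
  using cols_dim by blast

lemma cols_mult_in_vec_span:
  assumes "M \<in> carrier_mat n k" "X \<in> carrier_mat k l"
  shows "set (cols (M * X)) \<subseteq> vec_span n (set (cols M))"
proof
  fix v assume "v \<in> set (cols (M * X))"
  then obtain i where i: "i < l" "v = col (M * X) i"
    using assms by (auto simp: cols_def)
  hence "v = M *\<^sub>v col X i" using assms by (simp add: col_mult2)
  thus "v \<in> vec_span n (set (cols M))"
    unfolding vec_span_cols[OF assms(1)] using assms i by auto
qed

lemma dim_vec_span_indpt: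
  assumes "S \<subseteq> carrier_vec n" "finite S" "lin_indpt S"
  shows "vectorspace.dim class_ring (span_vs S) = card S"
  by (rule dim_span) (use assms in \<open>auto simp: maximal_def\<close>)

lemma dim_vec_span_full:
  assumes "vec_span n S = carrier_vec n"
  shows "vectorspace.dim class_ring (span_vs S) = n"
  using dim_vec_span_indpt[OF unit_vecs_carrier finite_set] unit_vecs_basis
    assms span_unit_vecs_is_carrier distinct_card[OF unit_vecs_distinct]
  by (simp add: basis_def)

text \<open>
  Orthonormal columns are the case \<open>L = M\<^sup>H\<close>; this is how every independence statement about
  \<open>Q\<^sub>1, \<dots>, Q\<^sub>k\<close> is obtained.
\<close>

lemma left_inverse_indpt:
  assumes M: "M \<in> carrier_mat n k" and L: "L \<in> carrier_mat k n" and LM: "L * M = 1\<^sub>m k"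
  shows "distinct (cols M)" "lin_indpt (set (cols M))"
proof -
  have inj: "x = y" if "x \<in> carrier_vec k" "y \<in> carrier_vec k" "M *\<^sub>v x = M *\<^sub>v y" for x y
  proof -
    have "(L * M) *\<^sub>v x = (L * M) *\<^sub>v y"
      using that M L by (simp add: assoc_mult_mat_vec[OF L M])
    thus ?thesis using that LM by simp
  qed
  show d: "distinct (cols M)"
    unfolding distinct_conv_nth
  proof (intro allI impI notI)
    fix i j assume ij: "i < length (cols M)" "j < length (cols M)" "i \<noteq> j" "cols M ! i = cols M ! j"
    hence "M *\<^sub>v unit_vec k i = M *\<^sub>v unit_vec k j"
      using M by (auto simp: mat_unit_vec_col)
    hence "unit_vec k i = (unit_vec k j :: complex vec)"
      by (rule inj[OF unit_vec_carrier unit_vec_carrier])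
    thus False using ij M by simp
  qed
  show "lin_indpt (set (cols M))"
  proof
    assume "lin_dep (set (cols M))"
    then obtain v where "v \<in> carrier_vec k" "v \<noteq> 0\<^sub>v k" "M *\<^sub>v v = 0\<^sub>v n"
      using lin_depE[OF M _ d] by blast
    moreover have "M *\<^sub>v 0\<^sub>v k = 0\<^sub>v n" using M by auto
    ultimately show False using inj[of v "0\<^sub>v k"] by simp
  qed
qed

text \<open>
  The rank depends only on the column space, so it can be read off any basis of that space.
\<close>

lemma rank_eq_of_left_inverse:
  assumes "N \<in> carrier_mat n k" "L \<in> carrier_mat k n" "L * N = 1\<^sub>m k"
    and "vec_span n (set (cols W)) = vec_span n (set (cols N))"
  shows "vec_space.rank n W = k"
proof -
  have "vec_space.rank n W = vec_space.rank n N" using assms(4) by (simp add: rank_def)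
  thus ?thesis using lin_indpt_full_rank[OF assms(1) left_inverse_indpt[OF assms(1-3)]] by simp
qed

lemma nonzero_vec_indpt: "v \<in> carrier_vec n \<Longrightarrow> v \<noteq> 0\<^sub>v n \<Longrightarrow> lin_indpt {v}"
  using lindep_span[of "{v}"] span_empty by auto

lemma rank_nonzero:
  fixes A :: "complex mat"
  assumes "A \<in> carrier_mat n k" "A \<noteq> 0\<^sub>m n k"
  shows "vec_space.rank n A \<ge> 1"
proof -
  obtain i j where ij: "i < n" "j < k" "A $$ (i, j) \<noteq> 0"
    using assms by (metis carrier_matD eq_matI index_zero_mat)
  have c: "col A j \<in> carrier_vec n" "col A j \<noteq> 0\<^sub>v n"
    using ij assms by (auto dest: arg_cong[of _ _ "\<lambda>v. v $ i"])
  have "{col A j} \<subseteq> set (cols A)" using ij assms by (auto simp: cols_def)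
  thus ?thesis using rank_ge_card_indpt[OF assms(1) _ nonzero_vec_indpt[OF c]] by simp
qed

end

lemma rank_one_outer_product:
  fixes A :: "complex mat"
  assumes "A \<in> carrier_mat m k" "A \<noteq> 0\<^sub>m m k"
    and "\<And>r c. r < m \<Longrightarrow> c < k \<Longrightarrow> A $$ (r, c) = f r * g c"
  shows "mat_rank A = 1"
  using rank_nonzero[OF assms(1,2)] vec_space.rank_le_1_product_entries[OF assms(1), of f g] assms
  by auto

lemma unitary_mat_adjoint: "unitary_mat n U \<Longrightarrow> unitary_mat n (mat_adjoint U)"
  by (auto simp: unitary_mat_def)

context
  fixes n :: nat
begin

interpretation vec_space "TYPE(complex)" n .

lemma mult_mat_vec_span:
  assumes M: "M \<in> carrier_mat n n" and S: "S \<subseteq> carrier_vec n" and T: "T \<subseteq> carrier_vec n"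
    and ST: "\<And>s. s \<in> S \<Longrightarrow> M *\<^sub>v s \<in> vec_span n T" and v: "v \<in> vec_span n S"
  shows "M *\<^sub>v v \<in> vec_span n T"
  using v S
proof (induction rule: vec_span_induct)
  case zero
  have "M *\<^sub>v 0\<^sub>v n = 0\<^sub>v n" using M by auto
  thus ?case by (simp add: vec_span_zero)
next
  case (add v w)
  thus ?case using M T by (simp add: mult_add_distrib_mat_vec vec_span_add)
next
  case (smult c v)
  thus ?case using M T by (simp add: mult_mat_vec vec_span_smult)
qed (use ST in auto)

text \<open>
  The columns of \<open>X\<close> are coordinate vectors of the columns of \<open>N\<close>.
\<close>

lemma factor_through_cols:
  assumes M: "M \<in> carrier_mat n k" and N: "N \<in> carrier_mat n l"
    and sub: "set (cols N) \<subseteq> vec_span n (set (cols M))"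
  obtains X where "X \<in> carrier_mat k l" "N = M * X"
proof -
  have "\<exists>x \<in> carrier_vec k. col N j = M *\<^sub>v x" if "j < l" for j
  proof -
    have "col N j \<in> set (cols N)" using that N by (simp add: cols_def)
    thus ?thesis using sub unfolding vec_span_cols[OF M] by auto
  qed
  then obtain f where f: "\<And>j. j < l \<Longrightarrow> f j \<in> carrier_vec k \<and> col N j = M *\<^sub>v f j"
    by metis
  define X where "X = mat_of_cols k (map f [0..<l])"
  have X: "X \<in> carrier_mat k l" by (auto simp: X_def intro!: carrier_matI)
  have cX: "col X j = f j" if "j < l" for j
    using f[OF that] that by (simp add: X_def)
  have "N = M * X"
  proof (rule eq_matI)
    fix i j assume "i < dim_row (M * X)" "j < dim_col (M * X)"
    hence ij: "i < n" "j < l" using M X by auto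
    have "N $$ (i, j) = col N j $ i" using ij N by simp
    also have "\<dots> = (M *\<^sub>v col X j) $ i" using f cX ij by simp
    finally show "N $$ (i, j) = (M * X) $$ (i, j)" using ij M X by simp
  qed (use M N X in auto)
  thus ?thesis using that X by blast
qed

text \<open>
  In finite dimension an invariant subspace of a unitary matrix is also invariant under its inverse:
  with the basis \<open>S\<close> as the columns of \<open>M\<close>, invariance reads \<open>U M = M X\<close>. The square matrix \<open>X\<close> is
  injective because \<open>U\<close> is, hence invertible, and \<open>U\<^sup>H M = M X\<^sup>-\<^sup>1\<close>.
\<close>

lemma unitary_invariant_reducing:
  assumes U: "unitary_mat n U" and S: "S \<subseteq> carrier_vec n" "finite S" "lin_indpt S"
    and inv: "\<And>s. s \<in> S \<Longrightarrow> U *\<^sub>v s \<in> vec_span n S"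
    and s: "s \<in> S"
  shows "mat_adjoint U *\<^sub>v s \<in> vec_span n S"
proof -
  obtain vs where vs: "set vs = S" "distinct vs" using finite_distinct_list[OF S(2)] by blast
  define k where "k = length vs"
  define M where "M = mat_of_cols n vs"
  have M: "M \<in> carrier_mat n k" by (simp add: M_def k_def)
  have cM: "cols M = vs" using vs S by (simp add: M_def)
  have Uc: "U \<in> carrier_mat n n" and UU: "mat_adjoint U * U = 1\<^sub>m n"
    using U by (auto simp: unitary_mat_def)
  have "set (cols (U * M)) \<subseteq> vec_span n (set (cols M))"
  proof
    fix v assume "v \<in> set (cols (U * M))"
    then obtain i where i: "i < k" "v = col (U * M) i"
      using M by (auto simp: cols_def)
    have "v = U *\<^sub>v (cols M ! i)" using M Uc i by (simp add: col_mult2)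
    thus "v \<in> vec_span n (set (cols M))" using inv[of "cols M ! i"] vs i M unfolding cM
      by (metis k_def nth_mem)
  qed
  then obtain X where X: "X \<in> carrier_mat k k" "U * M = M * X"
    using factor_through_cols[OF M] Uc M by (metis mult_carrier_mat)
  have "det X \<noteq> 0"
  proof
    assume "det X = 0"
    then obtain v where v: "v \<in> carrier_vec k" "v \<noteq> 0\<^sub>v k" "X *\<^sub>v v = 0\<^sub>v k"
      using det_0_iff_vec_prod_zero[OF X(1)] by blast
    have "M *\<^sub>v v = (mat_adjoint U * U) *\<^sub>v (M *\<^sub>v v)" using UU M v by simp
    also have "\<dots> = mat_adjoint U *\<^sub>v ((U * M) *\<^sub>v v)"
      using Uc M v by (simp add: assoc_mult_mat_vec[of _ n n _ n] assoc_mult_mat_vec[of _ n n _ k])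
    also have "(U * M) *\<^sub>v v = M *\<^sub>v (X *\<^sub>v v)"
      unfolding X(2) using M X v by (simp add: assoc_mult_mat_vec[of _ n k _ k])
    also have "\<dots> = 0\<^sub>v n" using v M by auto
    also have "mat_adjoint U *\<^sub>v 0\<^sub>v n = 0\<^sub>v n" using Uc by auto
    finally have "lin_dep (set (cols M))"
      using lin_depI[OF M v(1,2)] vs cM by simp
    thus False using S cM vs by simp
  qed
  from det_non_zero_imp_unit[OF X(1) this, of undefined]
  obtain Y where Y: "Y \<in> carrier_mat k k" "X * Y = 1\<^sub>m k"
    by (auto simp: Units_def ring_mat_def)
  have "mat_adjoint U * M = mat_adjoint U * (M * (X * Y))" using M Y by simp
  also have "M * (X * Y) = (U * M) * Y"
    unfolding X(2) using M X Y by (simp add: assoc_mult_mat[of _ n k _ k _ k])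
  also have "\<dots> = U * (M * Y)"
    using M Uc Y by (simp add: assoc_mult_mat[of _ n n _ k _ k])
  also have "mat_adjoint U * (U * (M * Y)) = (mat_adjoint U * U) * (M * Y)"
    using assoc_mult_mat[of "mat_adjoint U" n n U n "M * Y" k] Uc M Y by simp
  also have "\<dots> = M * Y" using UU M Y by simp
  finally have eq: "mat_adjoint U * M = M * Y" .
  obtain i where i: "i < k" "vs ! i = s" using s vs by (auto simp: in_set_conv_nth k_def)
  hence "mat_adjoint U *\<^sub>v s = col (mat_adjoint U * M) i"
    using M Uc cols_nth[of i M] unfolding cM by (simp add: col_mult2[of _ n n _ k])
  also have "\<dots> \<in> set (cols (M * Y))"
    unfolding eq using i M Y by (auto simp: cols_def)
  finally show ?thesis using cols_mult_in_vec_span[OF M Y(1)] cM vs by auto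
qed

lemma independent_spanning_card:
  assumes "S \<subseteq> carrier_vec n" "finite S" "lin_indpt S" "vec_span n S = carrier_vec n"
  shows "card S = n"
  using dim_vec_span_indpt[OF assms(1-3)] dim_vec_span_full[OF assms(4)] by simp

lemma same_span_same_card:
  assumes "S \<subseteq> carrier_vec n" "finite S" "lin_indpt S"
    and "T \<subseteq> carrier_vec n" "finite T" "lin_indpt T" and "vec_span n S = vec_span n T"
  shows "card S = card T"
  using dim_vec_span_indpt[OF assms(1-3)] dim_vec_span_indpt[OF assms(4-6)] assms(7) by simp

end

section \<open>Orbits of a unitary matrix\<close>

text \<open>
  The vectors \<open>U\<^sup>k z\<close> for all integers \<open>k\<close>, described by the recurrence alone: this makes the passage
  from \<open>U\<close> to \<open>U\<^sup>H\<close> a mere renumbering.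
\<close>

locale unitary_orbit =
  fixes n :: nat and U :: "complex mat" and u :: "int \<Rightarrow> complex vec"
  assumes unitary: "unitary_mat n U"
    and orbit_carrier [simp]: "u k \<in> carrier_vec n"
    and orbit_step: "U *\<^sub>v u k = u (k + 1)"
    and orbit_span: "vec_span n (range u) = carrier_vec n"
begin

interpretation vec_space "TYPE(complex)" n .

lemma U_carrier [simp]: "U \<in> carrier_mat n n"
  using unitary by (simp add: unitary_mat_def)

lemma orbit_subset [simp]: "u ` A \<subseteq> carrier_vec n" by auto

lemma orbit_step_adjoint: "mat_adjoint U *\<^sub>v u k = u (k - 1)"
proof -
  have "mat_adjoint U *\<^sub>v u k = (mat_adjoint U * U) *\<^sub>v u (k - 1)"
    using orbit_step[of "k - 1"] by (simp add: assoc_mult_mat_vec[of _ n n _ n])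
  thus ?thesis using unitary by (simp add: unitary_mat_def)
qed

text \<open>
  The reflection \<open>k \<mapsto> 1 - k\<close> exchanges the two starting vectors \<open>u\<^sub>0\<close> and \<open>u\<^sub>1\<close> and maps every window
  \<open>u\<^sub>1\<^sub>-\<^sub>k, \<dots>, u\<^sub>k\<close> to itself.
\<close>

lemma reversed_orbit: "unitary_orbit n (mat_adjoint U) (\<lambda>k. u (1 - k))"
proof
  have "range (\<lambda>k. u (1 - k)) = range u"
    by (auto intro: range_eqI[where x = "1 - _"])
  thus "vec_span n (range (\<lambda>k. u (1 - k))) = carrier_vec n" using orbit_span by simp
qed (use unitary in \<open>auto simp: unitary_mat_adjoint orbit_step_adjoint\<close>)

text \<open>
  One orbit vector generates all later ones through \<open>U\<close> and all earlier ones through \<open>U\<^sup>H\<close>.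
\<close>

lemma invariant_subspace_full:
  assumes S: "S \<subseteq> carrier_vec n" "finite S" "lin_indpt S"
    and inv: "\<And>s. s \<in> S \<Longrightarrow> U *\<^sub>v s \<in> vec_span n S"
    and a: "u a \<in> vec_span n S"
  shows "vec_span n S = carrier_vec n"
proof -
  have fwd: "u (a + int i) \<in> vec_span n S" for i
  proof (induction i)
    case (Suc i)
    have "U *\<^sub>v u (a + int i) \<in> vec_span n S"
      by (rule mult_mat_vec_span[OF U_carrier S(1) S(1) inv Suc.IH])
    thus ?case by (simp add: orbit_step algebra_simps)
  qed (use a in simp)
  have bwd: "u (a - int i) \<in> vec_span n S" for i
  proof (induction i)
    case (Suc i)
    have "mat_adjoint U *\<^sub>v u (a - int i) \<in> vec_span n S"
      by (rule mult_mat_vec_span[OF _ S(1) S(1) unitary_invariant_reducing[OF unitary S inv] Suc.IH])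
        auto
    thus ?case by (simp add: orbit_step_adjoint algebra_simps)
  qed (use a in simp)
  have "u k \<in> vec_span n S" for k
    using fwd[of "nat (k - a)"] bwd[of "nat (a - k)"] by (cases "k \<ge> a") auto
  hence "carrier_vec n \<subseteq> vec_span n S"
    unfolding orbit_span[symmetric] by (intro vec_span_minimal S) auto
  thus ?thesis using vec_span_carrier[OF S(1)] by auto
qed

text \<open>
  Adjoin the vectors one at a time. If the new vector depended on the earlier ones, their span would
  be invariant and therefore the whole space, although it is spanned by fewer than \<open>n\<close> vectors.
\<close>

lemma window_independent:
  assumes "l \<le> n"
  shows "card (u ` {a..<a + int l}) = l \<and> lin_indpt (u ` {a..<a + int l})"
  using assms
proof (induction l)
  case 0
  show ?case by (simp add: finite_lin_indpt2)
next
  case (Suc l)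
  let ?S = "u ` {a..<a + int l}"
  have IH: "card ?S = l" "lin_indpt ?S" using Suc by auto
  have S: "?S \<subseteq> carrier_vec n" "finite ?S" by auto
  have new: "u (a + int l) \<notin> vec_span n ?S"
  proof
    assume u: "u (a + int l) \<in> vec_span n ?S"
    have "U *\<^sub>v s \<in> vec_span n ?S" if "s \<in> ?S" for s
    proof -
      from that obtain k where k: "s = u k" "a \<le> k" "k < a + int l" by auto
      show ?thesis
      proof (cases "k + 1 = a + int l")
        case True
        thus ?thesis using u k by (simp add: orbit_step)
      next
        case False
        thus ?thesis using k by (auto simp: orbit_step intro!: vec_span_base)
      qed
    qed
    from invariant_subspace_full[OF S IH(2) this u]
    have "card ?S = n" by (intro independent_spanning_card S IH)
    thus False using IH Suc.prems by simp
  qed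
  have "u (a + int l) \<notin> ?S" using new vec_span_base[OF S(1)] by blast
  moreover have "{a..<a + int (Suc l)} = {a..<a + int l} \<union> {a + int l}" by auto
  hence "u ` {a..<a + int (Suc l)} = ?S \<union> {u (a + int l)}" by (simp add: image_Un)
  ultimately show ?case using lin_dep_iff_in_span[OF S(1) IH(2)] new IH(1) S by simp
qed

lemma window_full:
  assumes "n \<le> l"
  shows "vec_span n (u ` {a..<a + int l}) = carrier_vec n"
proof -
  let ?S = "u ` {a..<a + int n}"
  have "basis ?S" using window_independent[of n a]
    by (intro dim_li_is_basis) (auto simp: dim_is_n)
  hence "vec_span n ?S = carrier_vec n" by (simp add: basis_def)
  moreover have "vec_span n ?S \<subseteq> vec_span n (u ` {a..<a + int l})"
    using assms by (intro vec_span_mono) auto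
  ultimately show ?thesis using vec_span_carrier[of "u ` {a..<a + int l}" n] by auto
qed

text \<open>
  The span of \<open>l\<close> consecutive orbit vectors has dimension \<open>min l n\<close>, expressed as the size of any of
  its bases.
\<close>

lemma window_dim:
  assumes "S \<subseteq> carrier_vec n" "finite S" "lin_indpt S"
    and "vec_span n S = vec_span n (u ` {a..<a + int l})"
  shows "card S = min l n"
proof (cases "l \<le> n")
  case True
  have "card S = card (u ` {a..<a + int l})"
    using assms window_independent[OF True, of a] by (intro same_span_same_card) auto
  thus ?thesis using window_independent[OF True, of a] True by simp
next
  case False
  thus ?thesis using window_full[of l a] assms by (simp add: independent_spanning_card)
qed

end

section \<open>Orthonormal column blocks\<close>

definition block_cols :: "complex mat list \<Rightarrow> complex vec set"
  where "block_cols Qs = (\<Union>Q\<in>set Qs. set (cols Q))"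

text \<open>
  Says that the columns of all the blocks together form an orthonormal list, but block by block, which
  is the form that the Lanczos recurrence maintains.
\<close>

definition orthonormal_blocks :: "nat \<Rightarrow> complex mat list \<Rightarrow> bool"
  where "orthonormal_blocks n Qs \<longleftrightarrow>
    (\<forall>Q\<in>set Qs. dim_row Q = n) \<and>
    (\<forall>i<length Qs. \<forall>j<length Qs. mat_adjoint (Qs ! i) * Qs ! j =
       (if i = j then 1\<^sub>m (dim_col (Qs ! i)) else 0\<^sub>m (dim_col (Qs ! i)) (dim_col (Qs ! j))))"

lemma block_cols_append [simp]: "block_cols (Qs @ Qs') = block_cols Qs \<union> block_cols Qs'"
  and block_cols_single [simp]: "block_cols [Q] = set (cols Q)"
  by (auto simp: block_cols_def)

lemma block_cols_take_Suc:
  "k < length Qs \<Longrightarrow> block_cols (take (Suc k) Qs) = block_cols (take k Qs) \<union> set (cols (Qs ! k))"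
  by (simp add: take_Suc_conv_app_nth)

lemma block_cols_nth: "i < length Qs \<Longrightarrow> set (cols (Qs ! i)) \<subseteq> block_cols Qs"
  unfolding block_cols_def using nth_mem by blast

lemma block_cols_take_nth: "i < k \<Longrightarrow> k \<le> length Qs \<Longrightarrow> set (cols (Qs ! i)) \<subseteq> block_cols (take k Qs)"
  using block_cols_nth[of i "take k Qs"] by simp

lemma block_cols_takeE:
  assumes "s \<in> block_cols (take k Qs)"
  obtains i where "i < k" "i < length Qs" "s \<in> set (cols (Qs ! i))"
proof -
  obtain Q where "Q \<in> set (take k Qs)" "s \<in> set (cols Q)" using assms by (auto simp: block_cols_def)
  then obtain i where "i < length (take k Qs)" "Q = take k Qs ! i" by (metis in_set_conv_nth)
  thus ?thesis using that[of i] \<open>s \<in> set (cols Q)\<close> by simp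
qed

lemma finite_block_cols [simp]: "finite (block_cols Qs)"
  by (simp add: block_cols_def)

lemma block_cols_carrier: "\<forall>Q\<in>set Qs. dim_row Q = n \<Longrightarrow> block_cols Qs \<subseteq> carrier_vec n"
  unfolding block_cols_def using set_cols_carrier carrier_matI by blast

lemma block_cols_take_subset: "block_cols (take k Qs) \<subseteq> block_cols Qs"
  unfolding block_cols_def by (intro UN_mono set_take_subset) auto

lemma orthonormal_blocksD:
  assumes "orthonormal_blocks n Qs"
  shows "i < length Qs \<Longrightarrow> Qs ! i \<in> carrier_mat n (dim_col (Qs ! i))"
    and "i < length Qs \<Longrightarrow> mat_adjoint (Qs ! i) * Qs ! i = 1\<^sub>m (dim_col (Qs ! i))"
    and "i < length Qs \<Longrightarrow> j < length Qs \<Longrightarrow> i \<noteq> j \<Longrightarrow>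
      mat_adjoint (Qs ! i) * Qs ! j = 0\<^sub>m (dim_col (Qs ! i)) (dim_col (Qs ! j))"
    and "block_cols Qs \<subseteq> carrier_vec n"
  using assms by (auto simp: orthonormal_blocks_def intro!: carrier_matI block_cols_carrier[THEN subsetD])

lemma orthonormal_blocks_take: "orthonormal_blocks n Qs \<Longrightarrow> orthonormal_blocks n (take k Qs)"
  by (auto simp: orthonormal_blocks_def dest: in_set_takeD)

lemma sum_list_take_nth_less:
  fixes ds :: "nat list"
  assumes "i < length ds" "c < ds ! i"
  shows "sum_list (take i ds) + c < sum_list ds"
proof -
  have "sum_list ds = sum_list (take i ds) + ds ! i + sum_list (drop (Suc i) ds)"
    using assms(1) by (metis id_take_nth_drop sum_list.Cons sum_list_append add.assoc)
  thus ?thesis using assms(2) by simp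
qed

text \<open>
  A column index of \<open>[Q\<^sub>1 | \<dots> | Q\<^sub>p]\<close> splits into the number of a block and a position within it.
\<close>

lemma sum_list_split_index:
  fixes ds :: "nat list"
  assumes "r < sum_list ds"
  obtains i c where "i < length ds" "c < ds ! i" "r = sum_list (take i ds) + c"
  using assms
proof (induction ds arbitrary: r thesis)
  case (Cons d ds)
  show ?case
  proof (cases "r < d")
    case True
    thus ?thesis using Cons.prems(1)[of 0 r] by simp
  next
    case False
    hence "r - d < sum_list ds" using Cons.prems by simp
    then obtain i c where "i < length ds" "c < ds ! i" "r - d = sum_list (take i ds) + c"
      using Cons.IH by blast
    thus ?thesis using Cons.prems(1)[of "Suc i" c] False by simp
  qed
qed simp

lemma nth_concat_block:
  assumes "i < length xss" "c < length (xss ! i)"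
  shows "concat xss ! (sum_list (take i (map length xss)) + c) = xss ! i ! c"
  using assms
proof (induction xss arbitrary: i)
  case (Cons xs xss)
  thus ?case by (cases i) (auto simp: nth_append)
qed simp

lemma cols_concat_cols:
  assumes "\<forall>Q\<in>set Qs. dim_row Q = n"
  shows "cols (concat_cols n Qs) = concat (map cols Qs)"
  unfolding concat_cols_def
  by (rule cols_mat_of_cols) (use block_cols_carrier[OF assms] in \<open>auto simp: block_cols_def\<close>)

lemma length_concat_cols: "length (concat (map cols Qs)) = sum_list (map dim_col Qs)"
  by (induction Qs) auto

lemma concat_cols_carrier:
  "concat_cols n Qs \<in> carrier_mat n (sum_list (map dim_col Qs))"
  unfolding concat_cols_def by (auto simp: length_concat_cols intro!: carrier_matI)

lemma concat_cols_dim [simp]: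
  "dim_row (concat_cols n Qs) = n" "dim_col (concat_cols n Qs) = sum_list (map dim_col Qs)"
  using concat_cols_carrier[of n Qs] by auto

lemma set_cols_concat_cols:
  "\<forall>Q\<in>set Qs. dim_row Q = n \<Longrightarrow> set (cols (concat_cols n Qs)) = block_cols Qs"
  by (auto simp: cols_concat_cols block_cols_def)

lemma col_concat_cols:
  assumes "\<forall>Q\<in>set Qs. dim_row Q = n" "i < length Qs" "c < dim_col (Qs ! i)"
  shows "col (concat_cols n Qs) (sum_list (take i (map dim_col Qs)) + c) = col (Qs ! i) c"
proof -
  have "map length (map cols Qs) = map dim_col Qs" by simp
  hence "concat (map cols Qs) ! (sum_list (take i (map dim_col Qs)) + c) = col (Qs ! i) c"
    using nth_concat_block[of i "map cols Qs" c] assms(2,3) by (metis cols_length cols_nth length_map nth_map)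
  moreover have "sum_list (take i (map dim_col Qs)) + c < dim_col (concat_cols n Qs)"
    using sum_list_take_nth_less[of i "map dim_col Qs" c] assms(2,3) by simp
  ultimately show ?thesis using cols_concat_cols[OF assms(1)] cols_nth by metis
qed

lemma concat_cols_sandwich_index:
  assumes "\<forall>Q\<in>set Qs. dim_row Q = n" "A \<in> carrier_mat n n"
    and "i < length Qs" "c < dim_col (Qs ! i)" "j < length Qs" "d < dim_col (Qs ! j)"
  shows "(mat_adjoint (concat_cols n Qs) * A * concat_cols n Qs) $$
      (sum_list (take i (map dim_col Qs)) + c, sum_list (take j (map dim_col Qs)) + d) =
    (mat_adjoint (Qs ! i) * A * Qs ! j) $$ (c, d)"
proof -
  let ?r = "sum_list (take i (map dim_col Qs)) + c" and ?s = "sum_list (take j (map dim_col Qs)) + d"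
  have Q: "Qs ! i \<in> carrier_mat n (dim_col (Qs ! i))" "Qs ! j \<in> carrier_mat n (dim_col (Qs ! j))"
    using assms by (auto intro!: carrier_matI)
  have rs: "?r < sum_list (map dim_col Qs)" "?s < sum_list (map dim_col Qs)"
    using assms(3-6) by (auto intro!: sum_list_take_nth_less)
  show ?thesis
    unfolding sandwich_index[OF concat_cols_carrier assms(2) concat_cols_carrier rs]
      sandwich_index[OF Q(1) assms(2) Q(2) assms(4,6)]
      col_concat_cols[OF assms(1,3,4)] col_concat_cols[OF assms(1,5,6)] ..
qed

lemma orthonormal_concat_cols:
  assumes "orthonormal_blocks n Qs"
  shows "mat_adjoint (concat_cols n Qs) * concat_cols n Qs = 1\<^sub>m (sum_list (map dim_col Qs))"
proof (rule eq_matI)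
  let ?P = "concat_cols n Qs" and ?m = "sum_list (map dim_col Qs)"
  have rows: "\<forall>Q\<in>set Qs. dim_row Q = n" using assms by (simp add: orthonormal_blocks_def)
  fix r s assume "r < dim_row (1\<^sub>m ?m :: complex mat)" "s < dim_col (1\<^sub>m ?m :: complex mat)"
  hence rs: "r < ?m" "s < ?m" by auto
  obtain i c where i: "i < length Qs" "c < dim_col (Qs ! i)"
      "r = sum_list (take i (map dim_col Qs)) + c"
    using sum_list_split_index[OF rs(1)] by (metis length_map nth_map)
  obtain j d where j: "j < length Qs" "d < dim_col (Qs ! j)"
      "s = sum_list (take j (map dim_col Qs)) + d"
    using sum_list_split_index[OF rs(2)] by (metis length_map nth_map)
\<comment> \<open>the Gram matrix is the compression of the identity\<close>
  have "(mat_adjoint ?P * ?P) $$ (r, s) = (mat_adjoint ?P * 1\<^sub>m n * ?P) $$ (r, s)"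
    using right_mult_one_mat[of "mat_adjoint ?P" ?m n] mat_adjoint_carrier[OF concat_cols_carrier] by simp
  also have "\<dots> = (mat_adjoint (Qs ! i) * 1\<^sub>m n * Qs ! j) $$ (c, d)"
    unfolding i j by (rule concat_cols_sandwich_index) (use rows i j in auto)
  also have "mat_adjoint (Qs ! i) * 1\<^sub>m n = mat_adjoint (Qs ! i)"
    using orthonormal_blocksD(1)[OF assms i(1)] by (intro right_mult_one_mat) auto
  also have "(mat_adjoint (Qs ! i) * Qs ! j) $$ (c, d) = (if r = s then 1 else 0)"
  proof (cases "i = j")
    case True
    thus ?thesis using orthonormal_blocksD(2)[OF assms i(1)] i j by simp
  next
    case False
    have "r \<noteq> s"
    proof
      assume "r = s"
      have *: "sum_list (take i' ds) + c' < sum_list (take j' ds) + d'"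
        if "i' < j'" "j' < length ds" "c' < ds ! i'" for i' j' c' d' and ds :: "nat list"
      proof -
        have "sum_list (take i' (take j' ds)) + c' < sum_list (take j' ds)"
          using that by (intro sum_list_take_nth_less) auto
        thus ?thesis using that by (simp add: min_def)
      qed
      show False
        using *[of i j "map dim_col Qs" c d] *[of j i "map dim_col Qs" d c] i j \<open>r = s\<close> False
        by (cases "i < j") auto
    qed
    thus ?thesis using orthonormal_blocksD(3)[OF assms i(1) j(1) False] i j by simp
  qed
  finally show "(mat_adjoint ?P * ?P) $$ (r, s) = 1\<^sub>m ?m $$ (r, s)" using rs by simp
qed auto

lemma pick_interval:
  assumes "i < b"
  shows "pick {a..<a + b} i = a + i"
proof -
  have "{x \<in> {a..<a + b}. x < a + i} = {a..<a + i}" using assms by auto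
  thus ?thesis using pick_card_in_set[of "a + i" "{a..<a + b}"] assms by simp
qed

lemma submatrix_interval:
  assumes "a + b \<le> dim_row A" "c + d \<le> dim_col A"
  shows "submatrix A {a..<a + b} {c..<c + d} = mat b d (\<lambda>(i, j). A $$ (a + i, c + j))"
proof -
  have "{i. i < dim_row A \<and> i \<in> {a..<a + b}} = {a..<a + b}"
    "{j. j < dim_col A \<and> j \<in> {c..<c + d}} = {c..<c + d}" using assms by auto
  thus ?thesis unfolding submatrix_def
    by (intro eq_matI) (auto simp del: pick.simps simp: pick_interval)
qed

lemma mat_block_concat_cols:
  assumes rows: "\<forall>Q\<in>set Qs. dim_row Q = n" and A: "A \<in> carrier_mat n n"
    and ij: "i < length Qs" "j < length Qs"
  shows "mat_block (map dim_col Qs) (mat_adjoint (concat_cols n Qs) * A * concat_cols n Qs)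
      (Suc i) (Suc j) = mat_adjoint (Qs ! i) * A * Qs ! j"
proof -
  let ?T = "mat_adjoint (concat_cols n Qs) * A * concat_cols n Qs"
  let ?ds = "map dim_col Qs"
  have range: "block_range ?ds (Suc k) =
      {sum_list (take k ?ds)..<sum_list (take k ?ds) + dim_col (Qs ! k)}" if "k < length Qs" for k
    using that by (simp add: block_range_def take_Suc_conv_app_nth)
  have le: "sum_list (take k ?ds) + dim_col (Qs ! k) \<le> sum_list ?ds" if "k < length Qs" for k
  proof -
    have "sum_list (take (Suc k) ?ds) \<le> sum_list ?ds"
      by (metis append_take_drop_id le_add1 sum_list_append)
    thus ?thesis using that by (simp add: take_Suc_conv_app_nth)
  qed
  have dimT: "dim_row ?T = sum_list ?ds" "dim_col ?T = sum_list ?ds" by auto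
  show ?thesis
    unfolding mat_block_def range[OF ij(1)] range[OF ij(2)]
    by (subst submatrix_interval)
      (use dimT le ij concat_cols_sandwich_index[OF rows A] in \<open>auto intro!: eq_matI\<close>)
qed

context
  fixes n :: nat
begin

interpretation vec_space "TYPE(complex)" n .

lemma mult_mat_vec_span_zero:
  assumes M: "M \<in> carrier_mat m n" and S: "S \<subseteq> carrier_vec n"
    and zero: "\<And>s. s \<in> S \<Longrightarrow> M *\<^sub>v s = 0\<^sub>v m" and v: "v \<in> vec_span n S"
  shows "M *\<^sub>v v = 0\<^sub>v m"
  using v S
proof (induction rule: vec_span_induct)
  case zero
  show ?case using M by auto
next
  case (add v w)
  thus ?case using M by (simp add: mult_add_distrib_mat_vec)
next
  case (smult c v)
  have "c \<cdot>\<^sub>v 0\<^sub>v m = (0\<^sub>v m :: complex vec)" by auto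
  thus ?case using smult M by (simp add: mult_mat_vec)
qed (use zero in auto)

lemma orthonormal_blocks_independent:
  assumes "orthonormal_blocks n Qs"
  shows "lin_indpt (block_cols Qs)" "card (block_cols Qs) = sum_list (map dim_col Qs)"
proof -
  let ?P = "concat_cols n Qs"
  have rows: "\<forall>Q\<in>set Qs. dim_row Q = n" using assms by (simp add: orthonormal_blocks_def)
  note indpt = left_inverse_indpt[OF concat_cols_carrier
    mat_adjoint_carrier[OF concat_cols_carrier] orthonormal_concat_cols[OF assms]]
  show "lin_indpt (block_cols Qs)" using indpt(2) set_cols_concat_cols[OF rows] by simp
  show "card (block_cols Qs) = sum_list (map dim_col Qs)"
    using distinct_card[OF indpt(1)] set_cols_concat_cols[OF rows] by simp
qed

lemma orthonormal_blocks_annihilate: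
  assumes orth: "orthonormal_blocks n Qs" and i: "k \<le> i" "i < length Qs"
    and v: "v \<in> vec_span n (block_cols (take k Qs))"
  shows "mat_adjoint (Qs ! i) *\<^sub>v v = 0\<^sub>v (dim_col (Qs ! i))"
proof (rule mult_mat_vec_span_zero[OF _ _ _ v])
  show "mat_adjoint (Qs ! i) \<in> carrier_mat (dim_col (Qs ! i)) n"
    using orthonormal_blocksD(1)[OF orth i(2)] by (rule mat_adjoint_carrier)
  show "block_cols (take k Qs) \<subseteq> carrier_vec n"
    using orthonormal_blocksD(4)[OF orthonormal_blocks_take[OF orth]] .
  fix s assume "s \<in> block_cols (take k Qs)"
  then obtain j where j: "j < k" "j < length Qs" "s \<in> set (cols (Qs ! j))"
    by (rule block_cols_takeE)
  from j(3) obtain c where c: "c < dim_col (Qs ! j)" "s = col (Qs ! j) c" by (rule set_colsE)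
  have "mat_adjoint (Qs ! i) *\<^sub>v s = col (mat_adjoint (Qs ! i) * Qs ! j) c"
    unfolding c(2)
    by (rule col_adjoint_mult[OF orthonormal_blocksD(1)[OF orth i(2)]
          orthonormal_blocksD(1)[OF orth j(2)] c(1), symmetric])
  also have "mat_adjoint (Qs ! i) * Qs ! j = 0\<^sub>m (dim_col (Qs ! i)) (dim_col (Qs ! j))"
    using i j by (intro orthonormal_blocksD(3)[OF orth]) auto
  finally show "mat_adjoint (Qs ! i) *\<^sub>v s = 0\<^sub>v (dim_col (Qs ! i))" using c by simp
qed

text \<open>
  Split \<open>v\<close> as a vector in the span of the first \<open>k\<close> blocks plus \<open>Q y\<close> for the next block \<open>Q\<close>;
  applying \<open>Q\<^sup>H\<close> isolates \<open>y\<close>.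
\<close>

lemma orthonormal_blocks_drop_last:
  assumes orth: "orthonormal_blocks n Qs" and k: "k < length Qs"
    and v: "v \<in> vec_span n (block_cols (take (Suc k) Qs))"
    and zero: "mat_adjoint (Qs ! k) *\<^sub>v v = 0\<^sub>v (dim_col (Qs ! k))"
  shows "v \<in> vec_span n (block_cols (take k Qs))"
proof -
  let ?Q = "Qs ! k" and ?S = "block_cols (take k Qs)"
  define d where "d = dim_col ?Q"
  have Q: "?Q \<in> carrier_mat n d" unfolding d_def by (rule orthonormal_blocksD(1)[OF orth k])
  have S: "?S \<subseteq> carrier_vec n"
    using orthonormal_blocksD(4)[OF orthonormal_blocks_take[OF orth]] .
  have "v \<in> vec_span n (?S \<union> set (cols ?Q))"
    using v block_cols_take_Suc[OF k] by simp
  moreover have "?S \<union> set (cols ?Q) \<subseteq> carrier_vec n" using S set_cols_carrier[OF Q] by auto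
  ultimately have "\<exists>a y. a \<in> vec_span n ?S \<and> y \<in> carrier_vec d \<and> v = a + ?Q *\<^sub>v y"
  proof (induction rule: vec_span_induct)
    case zero
    have "0\<^sub>v n = 0\<^sub>v n + ?Q *\<^sub>v 0\<^sub>v d" using Q by auto
    thus ?case using vec_span_zero[of n ?S] zero_carrier_vec[of d] by blast
  next
    case (base s)
    show ?case
    proof (cases "s \<in> ?S")
      case True
      have "s + ?Q *\<^sub>v 0\<^sub>v d = s + 0\<^sub>v n" using Q by auto
      also have "\<dots> = s" using True S by auto
      finally have "s + ?Q *\<^sub>v 0\<^sub>v d = s" .
      thus ?thesis using vec_span_base[OF S True] zero_carrier_vec[of d] by metis
    next
      case False
      hence "s \<in> vec_span n (set (cols ?Q))"
        using base vec_span_base[OF set_cols_carrier[OF Q]] by auto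
      then obtain y where y: "y \<in> carrier_vec d" "s = ?Q *\<^sub>v y"
        unfolding vec_span_cols[OF Q] by auto
      hence "s = 0\<^sub>v n + ?Q *\<^sub>v y" using Q by auto
      thus ?thesis using vec_span_zero[of n ?S] y(1) by blast
    qed
  next
    case (add v w)
    then obtain a y b z where *: "a \<in> vec_span n ?S" "y \<in> carrier_vec d" "v = a + ?Q *\<^sub>v y"
      "b \<in> vec_span n ?S" "z \<in> carrier_vec d" "w = b + ?Q *\<^sub>v z" by blast
    have car: "a \<in> carrier_vec n" "b \<in> carrier_vec n" "?Q *\<^sub>v y \<in> carrier_vec n" "?Q *\<^sub>v z \<in> carrier_vec n"
      using * vec_span_carrier[OF S] Q by auto
    have "v + w = (a + b) + (?Q *\<^sub>v y + ?Q *\<^sub>v z)"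
      unfolding * by (rule eq_vecI) (use car in auto)
    also have "?Q *\<^sub>v y + ?Q *\<^sub>v z = ?Q *\<^sub>v (y + z)"
      using Q * by (simp add: mult_add_distrib_mat_vec)
    finally have "v + w = (a + b) + ?Q *\<^sub>v (y + z)" .
    moreover have "a + b \<in> vec_span n ?S" using vec_span_add[OF S *(1,4)] .
    moreover have "y + z \<in> carrier_vec d" using * by auto
    ultimately show ?case by blast
  next
    case (smult c v)
    then obtain a y where *: "a \<in> vec_span n ?S" "y \<in> carrier_vec d" "v = a + ?Q *\<^sub>v y" by blast
    have car: "a \<in> carrier_vec n" "?Q *\<^sub>v y \<in> carrier_vec n"
      using * vec_span_carrier[OF S] Q by auto
    have "c \<cdot>\<^sub>v v = c \<cdot>\<^sub>v a + ?Q *\<^sub>v (c \<cdot>\<^sub>v y)"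
      unfolding * using car Q *(2) by (simp add: smult_add_distrib_vec[of _ n] mult_mat_vec)
    moreover have "c \<cdot>\<^sub>v a \<in> vec_span n ?S" using vec_span_smult[OF S *(1)] .
    moreover have "c \<cdot>\<^sub>v y \<in> carrier_vec d" using * by auto
    ultimately show ?case by blast
  qed
  then obtain a y where ay: "a \<in> vec_span n ?S" "y \<in> carrier_vec d" "v = a + ?Q *\<^sub>v y" by blast
  have a: "a \<in> carrier_vec n" using vec_span_carrier[OF S ay(1)] .
  have "mat_adjoint ?Q *\<^sub>v v = mat_adjoint ?Q *\<^sub>v a + mat_adjoint ?Q *\<^sub>v (?Q *\<^sub>v y)"
    unfolding ay(3) using Q a ay(2) by (intro mult_add_distrib_mat_vec) auto
  also have "mat_adjoint ?Q *\<^sub>v a = 0\<^sub>v d"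
    unfolding d_def by (rule orthonormal_blocks_annihilate[OF orth le_refl k ay(1)])
  also have "mat_adjoint ?Q *\<^sub>v (?Q *\<^sub>v y) = (mat_adjoint ?Q * ?Q) *\<^sub>v y"
    using Q ay(2) by (intro assoc_mult_mat_vec[symmetric]) auto
  also have "\<dots> = y" using orthonormal_blocksD(2)[OF orth k, folded d_def] ay(2) by simp
  finally have "y = 0\<^sub>v d" using zero[folded d_def] ay(2) by simp
  hence "v = a" using ay(3) a Q by auto
  thus ?thesis using ay(1) by simp
qed

end

section \<open>A unitary matrix in an orthonormal basis adapted to an orbit\<close>

text \<open>
  Orthonormal blocks whose leading \<open>k\<close> blocks span the same space as the window
  \<open>u\<^sub>1\<^sub>-\<^sub>k, \<dots>, u\<^sub>k\<close>. This is all that is needed of the Lanczos blocks to determine the shape of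
  \<open>Q\<^sup>H U Q\<close>, and it is symmetric in \<open>U\<close> and \<open>U\<^sup>H\<close>.
\<close>

locale orbit_blocks = unitary_orbit +
  fixes Qs :: "complex mat list"
  assumes orthonormal: "orthonormal_blocks n Qs"
    and prefix_span: "1 \<le> k \<Longrightarrow> k \<le> length Qs \<Longrightarrow>
      vec_span n (block_cols (take k Qs)) = vec_span n (u ` {1 - int k..int k})"
begin

interpretation vec_space "TYPE(complex)" n .

text \<open>
  Everything shown about the blocks below the diagonal of \<open>Q\<^sup>H U Q\<close> transfers to those above it,
  which are adjoints of blocks below the diagonal of \<open>Q\<^sup>H U\<^sup>H Q\<close>.
\<close>

lemma reversed_blocks: "orbit_blocks n (mat_adjoint U) (\<lambda>k. u (1 - k)) Qs"
proof -
  have "(\<lambda>k. u (1 - k)) ` {1 - int k..int k} = u ` {1 - int k..int k}" for k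
  proof -
    have "(\<lambda>i. 1 - i) ` {1 - int k..int k} = {1 - int k..int k}"
      by (auto intro: image_eqI[where x = "1 - _"])
    thus ?thesis by (metis image_image)
  qed
  thus ?thesis
    unfolding orbit_blocks_def orbit_blocks_axioms_def
    using reversed_orbit orthonormal prefix_span by auto
qed

lemma block_carrier: "i < length Qs \<Longrightarrow> Qs ! i \<in> carrier_mat n (dim_col (Qs ! i))"
  using orthonormal_blocksD(1)[OF orthonormal] .

lemma prefix_carrier: "block_cols (take k Qs) \<subseteq> carrier_vec n"
  using orthonormal_blocksD(4)[OF orthonormal_blocks_take[OF orthonormal]] .

lemma prefix_size:
  assumes "1 \<le> k" "k \<le> length Qs"
  shows "sum_list (take k (map dim_col Qs)) = min (2 * k) n"
proof -
  have window: "{1 - int k..int k} = {1 - int k..<1 - int k + int (2 * k)}" by auto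
  note indpt = orthonormal_blocks_independent[OF orthonormal_blocks_take[OF orthonormal, of k]]
  have "card (block_cols (take k Qs)) = min (2 * k) n"
    using prefix_span[OF assms] unfolding window
    by (rule window_dim[OF prefix_carrier finite_block_cols indpt(1)])
  thus ?thesis by (simp add: take_map indpt(2))
qed

text \<open>
  \<open>U\<close> shifts the window up by one place, so compared with the span of the first \<open>i + 1\<close> blocks only the
  vector with index \<open>i + 2\<close> is new. The inclusion keeps this one-sided growth, which
  \<open>U_block_in_next_prefix\<close> gives away.
\<close>

lemma U_block_in_window:
  assumes i: "i < length Qs" and s: "s \<in> set (cols (Qs ! i))"
  shows "U *\<^sub>v s \<in> vec_span n (u ` {1 - int (Suc i)..int (Suc i) + 1})"
proof (rule mult_mat_vec_span[OF U_carrier orbit_subset orbit_subset])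
  have "s \<in> block_cols (take (Suc i) Qs)" using block_cols_take_nth[of i "Suc i" Qs] i s by auto
  thus "s \<in> vec_span n (u ` {1 - int (Suc i)..int (Suc i)})"
    using vec_span_base[OF prefix_carrier] prefix_span[of "Suc i"] i by auto
  fix w assume "w \<in> u ` {1 - int (Suc i)..int (Suc i)}"
  then obtain k where "w = u k" "1 - int (Suc i) \<le> k" "k \<le> int (Suc i)" by auto
  thus "U *\<^sub>v w \<in> vec_span n (u ` {1 - int (Suc i)..int (Suc i) + 1})"
    by (auto simp: orbit_step intro!: vec_span_base)
qed

lemma U_block_in_next_prefix:
  assumes i: "Suc i < length Qs" and s: "s \<in> set (cols (Qs ! i))"
  shows "U *\<^sub>v s \<in> vec_span n (block_cols (take (Suc (Suc i)) Qs))"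
proof -
  have "vec_span n (u ` {1 - int (Suc i)..int (Suc i) + 1})
      \<subseteq> vec_span n (u ` {1 - int (Suc (Suc i))..int (Suc (Suc i))})"
    by (intro vec_span_mono image_mono) auto
  thus ?thesis using U_block_in_window[OF _ s] prefix_span[of "Suc (Suc i)"] i by auto
qed

lemma far_below_diagonal_zero:
  assumes "Suc j < i" "i < length Qs"
  shows "mat_adjoint (Qs ! i) * U * Qs ! j = 0\<^sub>m (dim_col (Qs ! i)) (dim_col (Qs ! j))"
proof (rule zero_matI)
  have j: "j < length Qs" "Suc j < length Qs" using assms by auto
  show "mat_adjoint (Qs ! i) * U * Qs ! j \<in> carrier_mat (dim_col (Qs ! i)) (dim_col (Qs ! j))"
    by (intro mult_carrier_mat[of _ _ n] mat_adjoint_carrier block_carrier U_carrier assms(2) j(1))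
  fix c assume c: "c < dim_col (Qs ! j)"
  have "col (Qs ! j) c \<in> set (cols (Qs ! j))" using c by (simp add: cols_def)
  hence "U *\<^sub>v col (Qs ! j) c \<in> vec_span n (block_cols (take (Suc (Suc j)) Qs))"
    using U_block_in_next_prefix j by blast
  hence "mat_adjoint (Qs ! i) *\<^sub>v (U *\<^sub>v col (Qs ! j) c) = 0\<^sub>v (dim_col (Qs ! i))"
    using assms by (intro orthonormal_blocks_annihilate[OF orthonormal]) auto
  thus "col (mat_adjoint (Qs ! i) * U * Qs ! j) c = 0\<^sub>v (dim_col (Qs ! i))"
    using col_adjoint_triple[OF block_carrier[OF assms(2)] U_carrier block_carrier[OF j(1)] c] by simp
qed

text \<open>
  Multiplication by \<open>Q\<^sub>k\<^sub>+\<^sub>1\<^sup>H\<close> annihilates all vectors of the shifted window but the last one.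
\<close>

lemma subdiagonal_outer_product:
  assumes k: "Suc k < length Qs"
  obtains f g where "\<And>r c. r < dim_col (Qs ! Suc k) \<Longrightarrow> c < dim_col (Qs ! k) \<Longrightarrow>
    (mat_adjoint (Qs ! Suc k) * U * Qs ! k) $$ (r, c) = f r * g c"
proof -
  let ?Q = "Qs ! Suc k"
  let ?x = "mat_adjoint ?Q *\<^sub>v u (int (Suc k) + 1)"
  define m l where "m = dim_col ?Q" and "l = dim_col (Qs ! k)"
  have Q: "?Q \<in> carrier_mat n m" "Qs ! k \<in> carrier_mat n l"
    unfolding m_def l_def using k by (auto intro!: block_carrier)
\<comment> \<open>the column factor of the product is the image of the one new orbit vector\<close>
  have mult: "\<exists>a. mat_adjoint ?Q *\<^sub>v v = a \<cdot>\<^sub>v ?x"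
    if "v \<in> vec_span n (u ` {1 - int (Suc k)..int (Suc k) + 1})" for v
    using that orbit_subset
  proof (induction rule: vec_span_induct)
    case zero
    have "mat_adjoint ?Q *\<^sub>v 0\<^sub>v n = 0 \<cdot>\<^sub>v ?x" using Q by auto
    thus ?case by blast
  next
    case (base s)
    then obtain i where i: "s = u i" "1 - int (Suc k) \<le> i" "i \<le> int (Suc k) + 1" by auto
    show ?case
    proof (cases "i = int (Suc k) + 1")
      case True
      hence "mat_adjoint ?Q *\<^sub>v s = 1 \<cdot>\<^sub>v ?x" using i by auto
      thus ?thesis by blast
    next
      case False
      hence "s \<in> vec_span n (block_cols (take (Suc k) Qs))"
        using i k prefix_span[of "Suc k"] by (auto intro!: vec_span_base)
      hence "mat_adjoint ?Q *\<^sub>v s = 0\<^sub>v (m)"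
        unfolding m_def using k by (intro orthonormal_blocks_annihilate[OF orthonormal]) auto
      also have "\<dots> = 0 \<cdot>\<^sub>v ?x" using Q by (intro eq_vecI) auto
      finally show ?thesis by blast
    qed
  next
    case (add v w)
    then obtain a b where "mat_adjoint ?Q *\<^sub>v v = a \<cdot>\<^sub>v ?x" "mat_adjoint ?Q *\<^sub>v w = b \<cdot>\<^sub>v ?x" by blast
    hence "mat_adjoint ?Q *\<^sub>v (v + w) = (a + b) \<cdot>\<^sub>v ?x"
      using add Q by (simp add: mult_add_distrib_mat_vec[of _ m n] add_smult_distrib_vec)
    thus ?case by blast
  next
    case (smult c v)
    then obtain a where "mat_adjoint ?Q *\<^sub>v v = a \<cdot>\<^sub>v ?x" by blast
    hence "mat_adjoint ?Q *\<^sub>v (c \<cdot>\<^sub>v v) = (c * a) \<cdot>\<^sub>v ?x"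
      using smult Q by (simp add: mult_mat_vec[of _ m n] smult_smult_assoc)
    thus ?case by blast
  qed
  have "\<exists>a. col (mat_adjoint ?Q * U * Qs ! k) c = a \<cdot>\<^sub>v ?x" if c: "c < l" for c
  proof -
    have "col (Qs ! k) c \<in> set (cols (Qs ! k))" using c by (simp add: cols_def l_def)
    thus ?thesis
      using mult[OF U_block_in_window] k col_adjoint_triple[OF Q(1) U_carrier Q(2) c] by simp
  qed
  then obtain g where g: "\<And>c. c < l \<Longrightarrow>
      col (mat_adjoint ?Q * U * Qs ! k) c = g c \<cdot>\<^sub>v ?x" by metis
  have "(mat_adjoint ?Q * U * Qs ! k) $$ (r, c) = ?x $ r * g c"
    if rc: "r < m" "c < l" for r c
  proof -
    have "(mat_adjoint ?Q * U * Qs ! k) $$ (r, c) = col (mat_adjoint ?Q * U * Qs ! k) c $ r"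
      using rc Q by simp
    thus ?thesis using g[OF rc(2)] rc Q by simp
  qed
  thus ?thesis unfolding m_def l_def by (rule that)
qed

text \<open>
  If the block vanished, \<open>U\<close> would map the span of the first \<open>k + 1\<close> blocks into itself: earlier
  blocks stay inside anyway, and the image of the last one would have no component along the next
  block. An invariant subspace containing an orbit vector is the whole space, but this one is spanned
  by fewer than \<open>n\<close> columns.
\<close>

lemma subdiagonal_nonzero:
  assumes k: "Suc k < length Qs" and small: "sum_list (take (Suc k) (map dim_col Qs)) < n"
  shows "mat_adjoint (Qs ! Suc k) * U * Qs ! k \<noteq> 0\<^sub>m (dim_col (Qs ! Suc k)) (dim_col (Qs ! k))"
proof
  let ?S = "block_cols (take (Suc k) Qs)"
  assume zero: "mat_adjoint (Qs ! Suc k) * U * Qs ! k = 0\<^sub>m (dim_col (Qs ! Suc k)) (dim_col (Qs ! k))"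
  have indpt: "lin_indpt ?S" and card: "card ?S = sum_list (take (Suc k) (map dim_col Qs))"
    using orthonormal_blocks_independent[OF orthonormal_blocks_take[OF orthonormal, of "Suc k"]]
    by (auto simp: take_map)
  have "U *\<^sub>v s \<in> vec_span n ?S" if "s \<in> ?S" for s
    using that
  proof (rule block_cols_takeE)
    fix i assume i: "i < Suc k" "i < length Qs" "s \<in> set (cols (Qs ! i))"
    have step: "U *\<^sub>v s \<in> vec_span n (block_cols (take (Suc (Suc i)) Qs))"
      using U_block_in_next_prefix[of i s] i k by auto
    show ?thesis
    proof (cases "i = k")
      case True
      obtain c where c: "c < dim_col (Qs ! k)" "s = col (Qs ! k) c"
        using i(3) True by (auto elim: set_colsE)
      have "mat_adjoint (Qs ! Suc k) *\<^sub>v (U *\<^sub>v s) = col (mat_adjoint (Qs ! Suc k) * U * Qs ! k) c"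
        unfolding c(2) using col_adjoint_triple[OF block_carrier U_carrier block_carrier c(1)] k by simp
      hence "mat_adjoint (Qs ! Suc k) *\<^sub>v (U *\<^sub>v s) = 0\<^sub>v (dim_col (Qs ! Suc k))"
        using zero c by simp
      thus ?thesis using orthonormal_blocks_drop_last[OF orthonormal k] step True by simp
    next
      case False
      have "block_cols (take (Suc (Suc i)) Qs) \<subseteq> ?S"
        using block_cols_take_subset[of "Suc (Suc i)" "take (Suc k) Qs"] False i by (simp add: min_def split: if_splits)
      thus ?thesis using step vec_span_mono[OF prefix_carrier] by blast
    qed
  qed
  moreover have "u 1 \<in> vec_span n ?S"
    using prefix_span[of "Suc k"] k by (auto intro!: vec_span_base)
  ultimately have "vec_span n ?S = carrier_vec n"
    by (intro invariant_subspace_full[OF prefix_carrier finite_block_cols indpt])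
  hence "card ?S = n" by (intro independent_spanning_card prefix_carrier finite_block_cols indpt)
  thus False using card small by simp
qed

text \<open>
  The rank of the adjoint is the statement about the superdiagonal blocks, after exchanging the roles
  of \<open>U\<close> and \<open>U\<^sup>H\<close>.
\<close>

lemma subdiagonal_rank_one:
  assumes k: "Suc k < length Qs" and small: "sum_list (take (Suc k) (map dim_col Qs)) < n"
  shows "mat_rank (mat_adjoint (Qs ! Suc k) * U * Qs ! k) = 1"
    and "mat_rank (mat_adjoint (mat_adjoint (Qs ! Suc k) * U * Qs ! k)) = 1"
proof -
  let ?B = "mat_adjoint (Qs ! Suc k) * U * Qs ! k"
  have B: "?B \<in> carrier_mat (dim_col (Qs ! Suc k)) (dim_col (Qs ! k))"
    using block_carrier k by (intro mult_carrier_mat[of _ _ n]) auto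
  obtain f g where fg: "\<And>r c. r < dim_col (Qs ! Suc k) \<Longrightarrow> c < dim_col (Qs ! k) \<Longrightarrow>
    ?B $$ (r, c) = f r * g c" using subdiagonal_outer_product[OF k] by blast
  note nz = subdiagonal_nonzero[OF k small]
  show "mat_rank ?B = 1" using rank_one_outer_product[OF B nz fg] by blast
  have "mat_adjoint ?B \<noteq> 0\<^sub>m (dim_col (Qs ! k)) (dim_col (Qs ! Suc k))"
    using nz mat_adjoint_adjoint[of ?B] by (metis mat_adjoint_zero)
  moreover have "mat_adjoint ?B $$ (r, c) = conjugate (g r) * conjugate (f c)"
    if "r < dim_col (Qs ! k)" "c < dim_col (Qs ! Suc k)" for r c
    using that B fg[of c r] by (simp del: index_mult_mat)
  ultimately show "mat_rank (mat_adjoint ?B) = 1"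
    by (intro rank_one_outer_product[OF mat_adjoint_carrier[OF B]])
qed

end

context orbit_blocks
begin

lemma far_above_diagonal_zero:
  assumes "Suc i < j" "j < length Qs"
  shows "mat_adjoint (Qs ! i) * U * Qs ! j = 0\<^sub>m (dim_col (Qs ! i)) (dim_col (Qs ! j))"
proof -
  interpret rev: orbit_blocks n "mat_adjoint U" "\<lambda>k. u (1 - k)" Qs by (rule reversed_blocks)
  have i: "i < length Qs" using assms by simp
  have "mat_adjoint (Qs ! i) * U * Qs ! j = mat_adjoint (mat_adjoint (Qs ! j) * mat_adjoint U * Qs ! i)"
    using mat_adjoint_triple[OF block_carrier[OF assms(2)] rev.U_carrier block_carrier[OF i]] by simp
  thus ?thesis using rev.far_below_diagonal_zero[OF assms] by simp
qed

lemma superdiagonal_rank_one: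
  assumes k: "Suc k < length Qs" and small: "sum_list (take (Suc k) (map dim_col Qs)) < n"
  shows "mat_rank (mat_adjoint (Qs ! k) * U * Qs ! Suc k) = 1"
proof -
  interpret rev: orbit_blocks n "mat_adjoint U" "\<lambda>k. u (1 - k)" Qs by (rule reversed_blocks)
  have k': "k < length Qs" using k by simp
  have "mat_adjoint (Qs ! k) * U * Qs ! Suc k =
      mat_adjoint (mat_adjoint (Qs ! Suc k) * mat_adjoint U * Qs ! k)"
    using mat_adjoint_triple[OF block_carrier[OF k] rev.U_carrier block_carrier[OF k']] by simp
  thus ?thesis using rev.subdiagonal_rank_one(2)[OF k small] by simp
qed

lemma block_tridiagonal_compression:
  assumes "sum_list (map dim_col Qs) = n"
  shows "block_tridiagonal (map dim_col Qs) (mat_adjoint (concat_cols n Qs) * U * concat_cols n Qs)"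
  unfolding block_tridiagonal_def
proof (intro conjI ballI impI)
  have rows: "\<forall>Q\<in>set Qs. dim_row Q = n" using orthonormal by (simp add: orthonormal_blocks_def)
  show "mat_adjoint (concat_cols n Qs) * U * concat_cols n Qs
      \<in> carrier_mat (sum_list (map dim_col Qs)) (sum_list (map dim_col Qs))"
    by (intro mult_carrier_mat[of _ _ n] mat_adjoint_carrier concat_cols_carrier U_carrier)
  fix i j assume ij: "i \<in> {1..length (map dim_col Qs)}" "j \<in> {1..length (map dim_col Qs)}"
    and far: "i + 1 < j \<or> j + 1 < i"
  then obtain i' j' where s: "i = Suc i'" "j = Suc j'" by (cases i; cases j) auto
  have l: "i' < length Qs" "j' < length Qs" using ij s by auto
  have "mat_adjoint (Qs ! i') * U * Qs ! j' = 0\<^sub>m (dim_col (Qs ! i')) (dim_col (Qs ! j'))"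
    using far s l far_below_diagonal_zero far_above_diagonal_zero by auto
  thus "mat_block (map dim_col Qs) (mat_adjoint (concat_cols n Qs) * U * concat_cols n Qs) i j =
      0\<^sub>m (map dim_col Qs ! (i - 1)) (map dim_col Qs ! (j - 1))"
    using mat_block_concat_cols[OF rows U_carrier l] l s by simp
qed

lemma unitary_concat_cols:
  assumes "sum_list (map dim_col Qs) = n"
  shows "unitary_mat n (concat_cols n Qs)"
proof -
  have P: "concat_cols n Qs \<in> carrier_mat n n" using concat_cols_carrier[of n Qs] assms by simp
  moreover have PP: "mat_adjoint (concat_cols n Qs) * concat_cols n Qs = 1\<^sub>m n"
    using orthonormal_concat_cols[OF orthonormal] assms by simp
  ultimately show ?thesis
    using mat_mult_left_right_inverse[OF mat_adjoint_carrier[OF P] P PP] by (simp add: unitary_mat_def)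
qed

end

section \<open>The truncated singular value decomposition\<close>

lemma first_cols_eq:
  assumes "r \<le> dim_col A"
  shows "first_cols r A = mat (dim_row A) r (\<lambda>(i, j). A $$ (i, j))"
proof -
  have "{j. j < dim_col A \<and> j \<in> {..<r}} = {0..<r}" using assms by auto
  moreover have "pick {..<r} j = j" if "j < r" for j
    using pick_interval[of j r 0] that by (simp add: lessThan_atLeast0)
  ultimately show ?thesis
    unfolding first_cols_def submatrix_def
    by (intro eq_matI) (auto simp: pick_UNIV simp del: pick.simps)
qed

lemma leading_block_eq:
  assumes "r \<le> dim_row A" "r \<le> dim_col A"
  shows "leading_block r A = mat r r (\<lambda>(i, j). A $$ (i, j))"
  using submatrix_interval[of 0 r A 0 r] assms
  by (simp add: leading_block_def lessThan_atLeast0)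

text \<open>
  The singular values decrease, so the nonzero ones come first, and their number \<open>s\<close> is the rank: with
  the first \<open>s\<close> columns \<open>G\<^sub>s\<close> of \<open>G\<close> one has \<open>W = G\<^sub>s (R\<^sub>s V\<^sub>s\<^sup>H)\<close> and, conversely,
  \<open>G\<^sub>s = W (V\<^sub>s R\<^sub>s\<^sup>-\<^sup>1)\<close>. Hence the columns of \<open>G\<^sub>s\<close> form an orthonormal basis of the column space of
  \<open>W\<close>. These facts about \<open>Q\<^sub>j\<^sub>+\<^sub>1\<close> and \<open>B\<^sub>j\<close> are all that the analysis of the algorithm uses, whichever
  decomposition is chosen.
\<close>

lemma svd_truncation:
  assumes W: "W \<in> carrier_mat n c" and svd: "is_svd W G R V" and r: "r = mat_rank W"
  shows "first_cols r G \<in> carrier_mat n r"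
    and "mat_adjoint (first_cols r G) * first_cols r G = 1\<^sub>m r"
    and "leading_block r R * mat_adjoint (first_cols r V) \<in> carrier_mat r c"
    and "W = first_cols r G * (leading_block r R * mat_adjoint (first_cols r V))"
    and "\<exists>C \<in> carrier_mat c r. first_cols r G = W * C"
proof -
  have G: "G \<in> carrier_mat n n" "mat_adjoint G * G = 1\<^sub>m n"
    and V: "V \<in> carrier_mat c c" "mat_adjoint V * V = 1\<^sub>m c"
    using svd W by (auto simp: is_svd_def unitary_mat_def)
  obtain \<sigma> :: "nat \<Rightarrow> real" where nonneg: "\<And>i. 0 \<le> \<sigma> i"
    and anti: "antimono_on {..<min n c} \<sigma>"
    and R: "R = mat n c (\<lambda>(i, j). if i = j then complex_of_real (\<sigma> i) else 0)"
    using svd W unfolding is_svd_def by auto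
  have Wsvd: "W = G * R * mat_adjoint V" using svd by (simp add: is_svd_def)
  have Rc: "R \<in> carrier_mat n c" by (simp add: R)
  \<comment> \<open>the number of nonzero singular values, which turns out to be the rank\<close>
  define s where "s = (LEAST i. i = min n c \<or> \<sigma> i = 0)"
  have sm: "s = min n c \<or> \<sigma> s = 0" unfolding s_def by (rule LeastI[of _ "min n c"]) simp
  have s_le: "s \<le> min n c" unfolding s_def by (rule Least_le) simp
  have pos: "\<sigma> i \<noteq> 0" if "i < s" for i using not_less_Least[of i] that unfolding s_def by blast
  have zero: "\<sigma> i = 0" if "s \<le> i" "i < min n c" for i
  proof -
    have "\<sigma> i \<le> \<sigma> s" using anti that by (auto simp: monotone_on_def)
    moreover have "\<sigma> s = 0" using sm that by auto
    ultimately show ?thesis using nonneg[of i] by simp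
  qed
  have GR': "(G * R) $$ (i, k) = (if k < s then G $$ (i, k) * complex_of_real (\<sigma> k) else 0)"
    if ik: "i < n" "k < c" for i k
  proof -
    have "(G * R) $$ (i, k) = (\<Sum>l<n. G $$ (i, l) * (if l = k then complex_of_real (\<sigma> l) else 0))"
      using ik G by (simp add: R scalar_prod_def lessThan_atLeast0)
    also have "\<dots> = (\<Sum>l<n. if l = k then G $$ (i, l) * complex_of_real (\<sigma> l) else 0)"
      by (intro sum.cong) auto
    also have "\<dots> = (if k < n then G $$ (i, k) * complex_of_real (\<sigma> k) else 0)"
      by (simp add: sum.delta)
    finally show ?thesis using zero[of k] s_le ik by auto
  qed
  define K where "K = G * R"
  have K: "K \<in> carrier_mat n c" using G Rc by (simp add: K_def)
  have GR: "K $$ (i, k) = (if k < s then G $$ (i, k) * complex_of_real (\<sigma> k) else 0)"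
    if "i < n" "k < c" for i k using GR'[OF that] by (simp add: K_def)
  have WK: "W = K * mat_adjoint V" using Wsvd by (simp add: K_def)
  define Gs where "Gs = mat n s (\<lambda>(i, j). G $$ (i, j))"
  define D where "D = mat s c (\<lambda>(i, j). complex_of_real (\<sigma> i) * conjugate (V $$ (j, i)))"
  define C where "C = mat c s (\<lambda>(i, j). V $$ (i, j) / complex_of_real (\<sigma> j))"
  have car: "Gs \<in> carrier_mat n s" "D \<in> carrier_mat s c" "C \<in> carrier_mat c s"
    by (auto simp: Gs_def D_def C_def)
  have GsGs: "mat_adjoint Gs * Gs = 1\<^sub>m s"
  proof (rule eq_matI)
    fix i j assume "i < dim_row (1\<^sub>m s :: complex mat)" "j < dim_col (1\<^sub>m s :: complex mat)"
    hence ij: "i < s" "j < s" by auto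
    hence "(mat_adjoint Gs * Gs) $$ (i, j) = (mat_adjoint G * G) $$ (i, j)"
      using s_le G(1) by (auto simp: Gs_def scalar_prod_def intro!: sum.cong)
    also have "\<dots> = 1\<^sub>m s $$ (i, j)" unfolding G(2) using ij s_le by simp
    finally show "(mat_adjoint Gs * Gs) $$ (i, j) = 1\<^sub>m s $$ (i, j)" .
  qed (simp_all add: Gs_def)
  have WD: "W = Gs * D"
  proof (rule eq_matI)
    fix i j assume "i < dim_row (Gs * D)" "j < dim_col (Gs * D)"
    hence ij: "i < n" "j < c" using car by auto
    have "W $$ (i, j) = (\<Sum>k<c. K $$ (i, k) * conjugate (V $$ (j, k)))"
      unfolding WK using ij K V(1) by (simp add: scalar_prod_def lessThan_atLeast0)
    also have "\<dots> = (\<Sum>k<s. K $$ (i, k) * conjugate (V $$ (j, k)))"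
      using s_le ij by (intro sum.mono_neutral_right) (auto simp: GR)
    also have "\<dots> = (\<Sum>k<s. G $$ (i, k) * (complex_of_real (\<sigma> k) * conjugate (V $$ (j, k))))"
      using s_le ij by (intro sum.cong) (auto simp: GR)
    also have "\<dots> = (Gs * D) $$ (i, j)"
      using ij by (simp add: Gs_def D_def scalar_prod_def lessThan_atLeast0)
    finally show "W $$ (i, j) = (Gs * D) $$ (i, j)" .
  qed (use W car in auto)
  have GsC: "Gs = W * C"
  proof (rule eq_matI)
    fix i j assume "i < dim_row (W * C)" "j < dim_col (W * C)"
    hence ij: "i < n" "j < s" using W car by auto
    have "W * V = K * (mat_adjoint V * V)"
      unfolding WK using K V by (intro assoc_mult_mat[of _ n c _ c _ c]) auto
    hence WV: "W * V = K" using V K by simp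
    have "(W * C) $$ (i, j) = (W * V) $$ (i, j) / complex_of_real (\<sigma> j)"
      using ij W V s_le by (auto simp: C_def scalar_prod_def sum_divide_distrib)
    also have "\<dots> = G $$ (i, j)"
      unfolding WV using GR[of i j] ij s_le pos by simp
    finally show "Gs $$ (i, j) = (W * C) $$ (i, j)" using ij by (simp add: Gs_def)
  qed (use W car in auto)
  have "vec_span n (set (cols W)) = vec_span n (set (cols Gs))"
  proof (rule subset_antisym)
    show "vec_span n (set (cols W)) \<subseteq> vec_span n (set (cols Gs))"
      using cols_mult_in_vec_span[OF car(1,2)] WD vec_span_minimal set_cols_carrier car(1) by metis
    show "vec_span n (set (cols Gs)) \<subseteq> vec_span n (set (cols W))"
      using cols_mult_in_vec_span[OF W car(3)] GsC vec_span_minimal set_cols_carrier W by metis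
  qed
  hence rs: "r = s"
    unfolding r using rank_eq_of_left_inverse[OF car(1) mat_adjoint_carrier[OF car(1)] GsGs] W by simp
  have Gs: "first_cols r G = Gs"
    unfolding rs Gs_def using first_cols_eq[of s G] G s_le by simp
  have D: "leading_block r R * mat_adjoint (first_cols r V) = D"
  proof (rule eq_matI)
    have l: "leading_block r R = mat s s (\<lambda>(i, j). R $$ (i, j))"
      unfolding rs using leading_block_eq[of s R] Rc s_le by simp
    have f: "first_cols r V = mat c s (\<lambda>(i, j). V $$ (i, j))"
      unfolding rs using first_cols_eq[of s V] V s_le by simp
    show "dim_row (leading_block r R * mat_adjoint (first_cols r V)) = dim_row D"
      "dim_col (leading_block r R * mat_adjoint (first_cols r V)) = dim_col D"
      by (simp_all add: l f D_def)
    fix i j assume "i < dim_row D" "j < dim_col D"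
    hence ij: "i < s" "j < c" by (simp_all add: D_def)
    have "(leading_block r R * mat_adjoint (first_cols r V)) $$ (i, j) =
        (\<Sum>k<s. (if i = k then complex_of_real (\<sigma> i) else 0) * conjugate (V $$ (j, k)))"
      unfolding l f using ij s_le
      by (auto simp: scalar_prod_def R lessThan_atLeast0 intro!: sum.cong)
    also have "\<dots> = (\<Sum>k<s. if i = k then complex_of_real (\<sigma> i) * conjugate (V $$ (j, k)) else 0)"
      by (intro sum.cong) auto
    also have "\<dots> = D $$ (i, j)" using ij by (simp add: D_def)
    finally show "(leading_block r R * mat_adjoint (first_cols r V)) $$ (i, j) = D $$ (i, j)" .
  qed
  show "first_cols r G \<in> carrier_mat n r"
    "mat_adjoint (first_cols r G) * first_cols r G = 1\<^sub>m r"
    "leading_block r R * mat_adjoint (first_cols r V) \<in> carrier_mat r c"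
    "W = first_cols r G * (leading_block r R * mat_adjoint (first_cols r V))"
    "\<exists>C \<in> carrier_mat c r. first_cols r G = W * C"
    unfolding Gs D unfolding rs using car GsGs WD GsC by blast+
qed

section \<open>The block Lanczos recurrence\<close>

context
  fixes n :: nat
begin

interpretation vec_space "TYPE(complex)" n .

lemma cols_add_in_vec_span:
  assumes "A \<in> carrier_mat n l" "B \<in> carrier_mat n l" "S \<subseteq> carrier_vec n"
    and "set (cols A) \<subseteq> vec_span n S" "set (cols B) \<subseteq> vec_span n S"
  shows "set (cols (A + B)) \<subseteq> vec_span n S"
proof
  fix v assume "v \<in> set (cols (A + B))"
  then obtain j where j: "j < l" "v = col (A + B) j" using assms(2) by (auto elim: set_colsE)
  hence "v = col A j + col B j" using assms(1,2) by simp
  moreover have "col A j \<in> set (cols A)" "col B j \<in> set (cols B)"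
    using j assms(1,2) by (auto simp: cols_def)
  ultimately show "v \<in> vec_span n S" using assms(3-5) vec_span_add by blast
qed

lemma cols_diff_in_vec_span:
  assumes "A \<in> carrier_mat n l" "B \<in> carrier_mat n l" "S \<subseteq> carrier_vec n"
    and "set (cols A) \<subseteq> vec_span n S" "set (cols B) \<subseteq> vec_span n S"
  shows "set (cols (A - B)) \<subseteq> vec_span n S"
proof
  fix v assume "v \<in> set (cols (A - B))"
  then obtain j where j: "j < l" "v = col (A - B) j" using assms(2) by (auto elim: set_colsE)
  hence "v = col A j - col B j" using assms(1,2) by (intro eq_vecI) auto
  moreover have "col A j \<in> set (cols A)" "col B j \<in> set (cols B)"
    using j assms(1,2) by (auto simp: cols_def)
  ultimately show "v \<in> vec_span n S" using assms(3-5) vec_span_diff by blast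
qed

lemma cols_mult_left_in_vec_span:
  assumes "A \<in> carrier_mat n k" "X \<in> carrier_mat k l" "S \<subseteq> carrier_vec n"
    and "set (cols A) \<subseteq> vec_span n S"
  shows "set (cols (A * X)) \<subseteq> vec_span n S"
  using cols_mult_in_vec_span[OF assms(1,2)] vec_span_minimal[OF assms(3,4)] by blast

lemma vec_span_superset: "S \<subseteq> carrier_vec n \<Longrightarrow> T \<subseteq> S \<Longrightarrow> T \<subseteq> vec_span n S"
  using vec_span_base by blast

lemma orthonormal_blocks_annihilate_mat:
  assumes "orthonormal_blocks n Qs" "k \<le> i" "i < length Qs" "M \<in> carrier_mat n l"
    and "set (cols M) \<subseteq> vec_span n (block_cols (take k Qs))"
  shows "mat_adjoint (Qs ! i) * M = 0\<^sub>m (dim_col (Qs ! i)) l"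
proof (rule zero_matI)
  note Q = orthonormal_blocksD(1)[OF assms(1,3)]
  show "mat_adjoint (Qs ! i) * M \<in> carrier_mat (dim_col (Qs ! i)) l"
    by (rule mult_carrier_mat[OF mat_adjoint_carrier[OF Q] assms(4)])
  fix j assume j: "j < l"
  hence "col M j \<in> set (cols M)" using assms(4) by (simp add: cols_def)
  thus "col (mat_adjoint (Qs ! i) * M) j = 0\<^sub>v (dim_col (Qs ! i))"
    unfolding col_adjoint_mult[OF Q assms(4) j]
    using assms(5) by (intro orthonormal_blocks_annihilate[OF assms(1-3)]) blast
qed

end

text \<open>
  The invariant of the Lanczos process. Besides orthonormality it records that the blocks reduce \<open>H\<close> to
  block tridiagonal form with subdiagonal blocks \<open>B\<^sub>i\<close>, that \<open>H Q\<^sub>i\<close> stays in the span of the first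
  \<open>i + 1\<close> blocks, and that the next block comes from \<open>H Q\<^sub>i\<close> and its predecessors. By the last two,
  the leading blocks span the Krylov subspaces.
\<close>

definition lanczos_relations ::
  "nat \<Rightarrow> complex mat \<Rightarrow> complex mat list \<Rightarrow> complex mat list \<Rightarrow> bool"
  where "lanczos_relations n H Qs Bs \<longleftrightarrow>
    Qs \<noteq> [] \<and> length Qs = Suc (length Bs) \<and> orthonormal_blocks n Qs \<and>
    (\<forall>l<length Qs. \<forall>i<l. mat_adjoint (Qs ! l) * (H * Qs ! i) =
       (if l = Suc i then Bs ! i else 0\<^sub>m (dim_col (Qs ! l)) (dim_col (Qs ! i)))) \<and>
    (\<forall>i. Suc i < length Qs \<longrightarrow>
       set (cols (H * Qs ! i)) \<subseteq> vec_span n (block_cols (take (Suc (Suc i)) Qs)) \<and>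
       set (cols (Qs ! Suc i)) \<subseteq>
         vec_span n (block_cols (take (Suc i) Qs) \<union> set (cols (H * Qs ! i))))"

text \<open>
  The three-term recurrence subtracts from \<open>H Q\<^sub>j\<close> its full orthogonal projection \<open>E\<close> onto all the
  previous blocks. Only two of the components \<open>Q\<^sub>i\<^sup>H H Q\<^sub>j\<close> need to be subtracted: since \<open>H\<close> is Hermitian,
  the component along \<open>Q\<^sub>j\<^sub>-\<^sub>1\<close> is \<open>B\<^sub>j\<^sub>-\<^sub>1\<^sup>H\<close>, and those along earlier blocks vanish.
\<close>

lemma residual_is_projection_error:
  assumes rel: "lanczos_relations n H Qs Bs"
    and H: "H \<in> carrier_mat n n" "mat_adjoint H = H"
  obtains E where "E \<in> carrier_mat n (dim_col (last Qs))"
    and "lanczos_residual H Qs Bs = H * last Qs - E"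
    and "set (cols E) \<subseteq> vec_span n (block_cols Qs)"
    and "\<And>i. i < length Qs \<Longrightarrow> mat_adjoint (Qs ! i) * E = mat_adjoint (Qs ! i) * (H * last Qs)"
proof -
  define j where "j = length Qs - 1"
  define Q where "Q = last Qs"
  define d where "d = dim_col Q"
  have orth: "orthonormal_blocks n Qs" and len: "length Qs = Suc j" "length Bs = j"
    using rel by (auto simp: lanczos_relations_def j_def)
  have tri: "mat_adjoint (Qs ! l) * (H * Qs ! i) =
       (if l = Suc i then Bs ! i else 0\<^sub>m (dim_col (Qs ! l)) (dim_col (Qs ! i)))"
    if "l < length Qs" "i < l" for l i
    using rel that unfolding lanczos_relations_def by blast
  have Qj: "Qs ! j = Q" using len by (simp add: Q_def last_conv_nth flip: j_def length_greater_0_conv)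
  have jl: "j < length Qs" using len by simp
  have Q: "Q \<in> carrier_mat n d"
    using orthonormal_blocksD(1)[OF orth jl] unfolding Qj d_def .
  have QQ: "mat_adjoint Q * Q = 1\<^sub>m d"
    using orthonormal_blocksD(2)[OF orth, of j] len Qj by (simp add: d_def)
  have S: "block_cols Qs \<subseteq> carrier_vec n" by (rule orthonormal_blocksD(4)[OF orth])
  define A where "A = mat_adjoint Q * (H * Q)"
  have A: "A \<in> carrier_mat d d" unfolding A_def using Q H by (intro mult_carrier_mat[of _ _ n]) auto
  have A': "mat_adjoint Q * H * Q = A"
    unfolding A_def using Q H by (intro assoc_mult_mat[of _ d n _ n _ d]) auto
  have HQ: "H * Q \<in> carrier_mat n d" and QA: "Q * A \<in> carrier_mat n d" using H Q A by auto
  have QA_cols: "set (cols (Q * A)) \<subseteq> vec_span n (block_cols Qs)"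
    using block_cols_nth[of j Qs] len Qj
    by (intro cols_mult_left_in_vec_span[OF Q A S] vec_span_superset[OF S]) auto
  have QiQA: "mat_adjoint (Qs ! i) * (Q * A) = (if i = j then A else 0\<^sub>m (dim_col (Qs ! i)) d)"
    if i: "i < length Qs" for i
  proof -
    define m where "m = dim_col (Qs ! i)"
    have Qi: "Qs ! i \<in> carrier_mat n m" unfolding m_def by (rule orthonormal_blocksD(1)[OF orth i])
    have "mat_adjoint (Qs ! i) * (Q * A) = (mat_adjoint (Qs ! i) * Q) * A"
      using Qi Q A by (intro assoc_mult_mat[symmetric, of _ m n _ d _ d]) auto
    also have "\<dots> = (if i = j then A else 0\<^sub>m m d)"
    proof (cases "i = j")
      case True
      thus ?thesis using QQ A Qj by simp
    next
      case False
      hence "mat_adjoint (Qs ! i) * Q = 0\<^sub>m m d"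
        using orthonormal_blocksD(3)[OF orth i, of j] len Qj by (simp add: m_def d_def)
      thus ?thesis using False A by simp
    qed
    finally show ?thesis by (simp only: m_def)
  qed
  have far: "mat_adjoint (Qs ! i) * (H * Q) = 0\<^sub>m (dim_col (Qs ! i)) d" if "Suc i < j" for i
  proof -
    define m where "m = dim_col (Qs ! i)"
    have i: "i < length Qs" using that len by simp
    have Qi: "Qs ! i \<in> carrier_mat n m" unfolding m_def by (rule orthonormal_blocksD(1)[OF orth i])
    have "mat_adjoint Q * (H * Qs ! i) = 0\<^sub>m d m"
      using tri[of j i] that len Qj by (simp add: d_def m_def)
    hence "mat_adjoint (mat_adjoint Q * (H * Qs ! i)) = 0\<^sub>m m d" by simp
    thus ?thesis using hermitian_adjoint_swap[OF Q Qi H] by (simp add: m_def)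
  qed
  show ?thesis
  proof (cases j)
    case 0
\<comment> \<open>indices are shifted by one, so \<open>j = 0\<close> is the first pass, which has no block \<open>Q\<^sub>j\<^sub>-\<^sub>1\<close>\<close>
    have "lanczos_residual H Qs Bs = H * Q - Q * A"
      using 0 len by (simp add: lanczos_residual_def Q_def[symmetric] A' Let_def)
    moreover have "mat_adjoint (Qs ! i) * (Q * A) = mat_adjoint (Qs ! i) * (H * Q)"
      if "i < length Qs" for i
      using QiQA[OF that] that len 0 Qj by (simp add: A_def)
    ultimately show ?thesis
      using that[of "Q * A"] QA QA_cols unfolding d_def Q_def by blast
  next
    case (Suc j')
    define P where "P = Qs ! j'"
    define B where "B = Bs ! j'"
    define e where "e = dim_col P"
    have j': "j' < length Qs" "j' \<noteq> j" using Suc len by auto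
    have P: "P \<in> carrier_mat n e"
      unfolding P_def e_def by (rule orthonormal_blocksD(1)[OF orth j'(1)])
    have B_eq: "mat_adjoint Q * (H * P) = B"
      using tri[of j j'] len Suc Qj by (simp add: P_def B_def)
    have B: "B \<in> carrier_mat d e"
      unfolding B_eq[symmetric] using P Q H by (intro mult_carrier_mat[of _ _ n]) auto
    have B_eq': "mat_adjoint P * (H * Q) = mat_adjoint B"
      using hermitian_adjoint_swap[OF Q P H] B_eq by simp
    have PB: "P * mat_adjoint B \<in> carrier_mat n d" using P B by auto
    let ?E = "Q * A + P * mat_adjoint B"
    have Bs: "last Bs = B" using len Suc by (simp add: B_def last_conv_nth flip: length_greater_0_conv)
    have "lanczos_residual H Qs Bs = H * Q - Q * A - P * mat_adjoint B"
      using Suc len Bs by (simp add: lanczos_residual_def Q_def[symmetric] A' Let_def P_def)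
    also have "\<dots> = H * Q - ?E" by (rule diff_diff_mat[OF HQ QA PB])
    finally have res: "lanczos_residual H Qs Bs = H * Q - ?E" .
    have "set (cols (P * mat_adjoint B)) \<subseteq> vec_span n (block_cols Qs)"
      using block_cols_nth[OF j'(1)]
      by (intro cols_mult_left_in_vec_span[OF P _ S] vec_span_superset[OF S]) (use B in \<open>auto simp: P_def\<close>)
    hence cols: "set (cols ?E) \<subseteq> vec_span n (block_cols Qs)"
      by (rule cols_add_in_vec_span[OF QA PB S QA_cols])
    have proj: "mat_adjoint (Qs ! i) * ?E = mat_adjoint (Qs ! i) * (H * Q)" if i: "i < length Qs" for i
    proof -
      define m where "m = dim_col (Qs ! i)"
      have Qi: "Qs ! i \<in> carrier_mat n m" unfolding m_def by (rule orthonormal_blocksD(1)[OF orth i])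
      have "mat_adjoint (Qs ! i) * ?E =
          mat_adjoint (Qs ! i) * (Q * A) + mat_adjoint (Qs ! i) * (P * mat_adjoint B)"
        using Qi QA PB by (intro mult_add_distrib_mat[of _ m n]) auto
      also have "mat_adjoint (Qs ! i) * (P * mat_adjoint B) = (mat_adjoint (Qs ! i) * P) * mat_adjoint B"
        using Qi P B by (intro assoc_mult_mat[symmetric, of _ m n _ e _ d]) auto
      also have "\<dots> = (if i = j' then mat_adjoint B else 0\<^sub>m m d)"
      proof (cases "i = j'")
        case True
        thus ?thesis using orthonormal_blocksD(2)[OF orth i] B by (simp add: P_def e_def)
      next
        case False
        hence "mat_adjoint (Qs ! i) * P = 0\<^sub>m m e"
          using orthonormal_blocksD(3)[OF orth i j'(1)] by (simp add: m_def P_def e_def)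
        thus ?thesis using False B left_mult_zero_mat[OF mat_adjoint_carrier[OF B], of m] by simp
      qed
      also have "mat_adjoint (Qs ! i) * (Q * A) + \<dots> = mat_adjoint (Qs ! i) * (H * Q)"
      proof -
        consider "i = j" | "i = j'" | "Suc i < j" using i len Suc by linarith
        thus ?thesis
        proof cases
          case 1
          hence "m = d" using Qj by (simp add: m_def d_def)
          thus ?thesis using QiQA[OF i] 1 j' A Qj by (simp add: A_def)
        next
          case 2
          have "m = e" using 2 by (simp add: m_def e_def P_def)
          moreover have "mat_adjoint B \<in> carrier_mat e d" using B by simp
          ultimately show ?thesis using QiQA[OF i] 2 j' B_eq' by (simp add: P_def e_def)
        next
          case 3
          thus ?thesis using QiQA[OF i] far[OF 3] Suc by (simp add: m_def)
        qed
      qed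
      finally show ?thesis .
    qed
    show ?thesis
      using that[of ?E] add_carrier_mat[OF PB, of "Q * A"] res cols proj unfolding d_def Q_def by blast
  qed
qed

text \<open>
  The new block \<open>N\<close> inherits orthogonality to its predecessors from the residual, whose columns it
  spans. The relation \<open>W = N B\<close> gives \<open>N\<^sup>H H Q = B\<close> for the last block \<open>Q\<close>, and \<open>N\<^sup>H H Q\<^sub>i = 0\<close> for
  earlier ones because \<open>H Q\<^sub>i\<close> lies in the span of blocks orthogonal to \<open>N\<close>.
\<close>

lemma lanczos_relations_step:
  assumes rel: "lanczos_relations n H Qs Bs"
    and H: "H \<in> carrier_mat n n" "mat_adjoint H = H"
    and W: "W = lanczos_residual H Qs Bs"
    and N: "N \<in> carrier_mat n e" "mat_adjoint N * N = 1\<^sub>m e"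
    and B: "B \<in> carrier_mat e (dim_col (last Qs))" "W = N * B"
    and C: "C \<in> carrier_mat (dim_col (last Qs)) e" "N = W * C"
  shows "lanczos_relations n H (Qs @ [N]) (Bs @ [B])"
proof -
  define Q where "Q = last Qs"
  define d where "d = dim_col Q"
  define j where "j = length Qs"
  have ne: "Qs \<noteq> []" and orth: "orthonormal_blocks n Qs" and len: "length Bs = j - 1" "j > 0"
    using rel by (auto simp: lanczos_relations_def j_def)
  have Qj: "Qs ! (j - 1) = Q" using ne by (simp add: Q_def j_def last_conv_nth)
  have jl: "j - 1 < length Qs" using len by (simp add: j_def)
  have Q: "Q \<in> carrier_mat n d"
    using orthonormal_blocksD(1)[OF orth jl] unfolding Qj d_def .
  have S: "block_cols Qs \<subseteq> carrier_vec n" by (rule orthonormal_blocksD(4)[OF orth])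
  have B: "B \<in> carrier_mat e d" "W = N * B" and C: "C \<in> carrier_mat d e" "N = W * C"
    using B C by (auto simp: d_def Q_def)
  obtain E where E: "E \<in> carrier_mat n d" "W = H * Q - E" "set (cols E) \<subseteq> vec_span n (block_cols Qs)"
      "\<And>i. i < length Qs \<Longrightarrow> mat_adjoint (Qs ! i) * E = mat_adjoint (Qs ! i) * (H * Q)"
    using residual_is_projection_error[OF rel H] unfolding W d_def Q_def by metis
  have HQ: "H * Q \<in> carrier_mat n d" using H Q by auto
  have Wc: "W \<in> carrier_mat n d" using E(1,2) HQ by auto
  have HQ_eq: "H * Q = N * B + E"
    unfolding B(2)[symmetric] E(2) using HQ E(1) by (intro eq_matI) auto
  have QiN: "mat_adjoint (Qs ! i) * N = 0\<^sub>m (dim_col (Qs ! i)) e" if i: "i < length Qs" for i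
  proof -
    define m where "m = dim_col (Qs ! i)"
    have Qi: "mat_adjoint (Qs ! i) \<in> carrier_mat m n"
      unfolding m_def by (rule mat_adjoint_carrier[OF orthonormal_blocksD(1)[OF orth i]])
    have "mat_adjoint (Qs ! i) * W = mat_adjoint (Qs ! i) * (H * Q) - mat_adjoint (Qs ! i) * E"
      unfolding E(2) by (rule mult_minus_distrib_mat[OF Qi HQ E(1)])
    also have "\<dots> = 0\<^sub>m m d"
      unfolding E(4)[OF i] using mult_carrier_mat[OF Qi HQ] by (intro eq_matI) auto
    finally have "mat_adjoint (Qs ! i) * W = 0\<^sub>m m d" .
    moreover have "mat_adjoint (Qs ! i) * N = (mat_adjoint (Qs ! i) * W) * C"
      unfolding C(2) by (rule assoc_mult_mat[OF Qi Wc C(1), symmetric])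
    ultimately show ?thesis using C(1) by (simp add: m_def)
  qed
  have NQi: "mat_adjoint N * Qs ! i = 0\<^sub>m e (dim_col (Qs ! i))" if i: "i < length Qs" for i
  proof -
    have "mat_adjoint (mat_adjoint (Qs ! i) * N) = mat_adjoint N * Qs ! i"
      using carrier_matD[OF orthonormal_blocksD(1)[OF orth i]] carrier_matD[OF N(1)]
      by (simp add: mat_adjoint_mult)
    thus ?thesis using QiN[OF i] by simp
  qed
  let ?Qs = "Qs @ [N]"
  have orth': "orthonormal_blocks n ?Qs"
    unfolding orthonormal_blocks_def
  proof (intro conjI allI impI)
    show "\<forall>Q\<in>set ?Qs. dim_row Q = n" using orth N(1) by (auto simp: orthonormal_blocks_def)
    fix i l assume "i < length ?Qs" "l < length ?Qs"
    then consider "i < length Qs" "l < length Qs" | "i = length Qs" "l < length Qs"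
      | "i < length Qs" "l = length Qs" | "i = length Qs" "l = length Qs" by fastforce
    thus "mat_adjoint (?Qs ! i) * ?Qs ! l =
       (if i = l then 1\<^sub>m (dim_col (?Qs ! i)) else 0\<^sub>m (dim_col (?Qs ! i)) (dim_col (?Qs ! l)))"
      by cases (use orth N QiN NQi in \<open>auto simp: nth_append orthonormal_blocks_def\<close>)
  qed
  have ann: "mat_adjoint N * M = 0\<^sub>m e l"
    if "M \<in> carrier_mat n l" "set (cols M) \<subseteq> vec_span n (block_cols Qs)" for M l
    using orthonormal_blocks_annihilate_mat[OF orth', of "length Qs" "length Qs" M l] that N(1) by simp
  have tri: "mat_adjoint (?Qs ! l) * (H * ?Qs ! i) =
       (if l = Suc i then (Bs @ [B]) ! i else 0\<^sub>m (dim_col (?Qs ! l)) (dim_col (?Qs ! i)))"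
    if li: "l < length ?Qs" "i < l" for l i
  proof -
    consider "l < length Qs" | "l = length Qs" "Suc i = j" | "l = length Qs" "Suc i < j"
      using li unfolding j_def by fastforce
    thus ?thesis
    proof cases
      case 1
      hence "i < length Bs" if "l = Suc i" using that len by (simp add: j_def)
      thus ?thesis using 1 li rel by (auto simp: nth_append lanczos_relations_def)
    next
      case 2
      hence "i = j - 1" by simp
      hence i: "?Qs ! i = Q" "(Bs @ [B]) ! i = B" "l = Suc i"
        using 2 len jl Qj by (simp_all add: nth_append flip: j_def)
      have "mat_adjoint N * (H * Q) = mat_adjoint N * (N * B) + mat_adjoint N * E"
        unfolding HQ_eq using N(1) B(1) E(1) by (intro mult_add_distrib_mat[of _ e n _ d]) auto
      also have "mat_adjoint N * E = 0\<^sub>m e d" by (rule ann[OF E(1,3)])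
      also have "mat_adjoint N * (N * B) = (mat_adjoint N * N) * B"
        using N(1) B(1) by (intro assoc_mult_mat[symmetric, of _ e n _ e _ d]) auto
      also have "\<dots> + 0\<^sub>m e d = B" using N(2) B(1) by simp
      finally show ?thesis using 2 i by simp
    next
      case 3
      have "set (cols (H * Qs ! i)) \<subseteq> vec_span n (block_cols (take (Suc (Suc i)) Qs))"
        using rel 3 unfolding lanczos_relations_def j_def by blast
      also have "\<dots> \<subseteq> vec_span n (block_cols Qs)"
        by (rule vec_span_mono[OF S block_cols_take_subset])
      finally have "set (cols (H * Qs ! i)) \<subseteq> vec_span n (block_cols Qs)" .
      hence "mat_adjoint N * (H * Qs ! i) = 0\<^sub>m e (dim_col (Qs ! i))"
        using 3 by (intro ann mult_carrier_mat[OF H(1)] orthonormal_blocksD(1)[OF orth]) (auto simp: j_def)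
      thus ?thesis using 3 N(1) by (auto simp: nth_append j_def)
    qed
  qed
  have span1: "set (cols (H * ?Qs ! i)) \<subseteq> vec_span n (block_cols (take (Suc (Suc i)) ?Qs))"
    if i: "Suc i < length ?Qs" for i
  proof (cases "Suc i < length Qs")
    case True
    thus ?thesis using rel unfolding lanczos_relations_def by (auto simp: nth_append)
  next
    case False
    hence ij: "i = j - 1" "Suc i = length Qs" using i len by (auto simp: j_def)
    have S': "block_cols ?Qs \<subseteq> carrier_vec n" by (rule orthonormal_blocksD(4)[OF orth'])
    have "set (cols (N * B)) \<subseteq> vec_span n (block_cols ?Qs)"
      by (intro cols_mult_left_in_vec_span[OF N(1) B(1) S'] vec_span_superset[OF S']) auto
    moreover have "set (cols E) \<subseteq> vec_span n (block_cols ?Qs)"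
      using E(3) vec_span_mono[OF S', of "block_cols Qs"] by auto
    ultimately have "set (cols (H * Q)) \<subseteq> vec_span n (block_cols ?Qs)"
      unfolding HQ_eq using N(1) B(1) by (intro cols_add_in_vec_span[OF _ E(1) S']) auto
    thus ?thesis using ij Qj by (simp add: nth_append)
  qed
  have span2: "set (cols (?Qs ! Suc i)) \<subseteq>
      vec_span n (block_cols (take (Suc i) ?Qs) \<union> set (cols (H * ?Qs ! i)))"
    if i: "Suc i < length ?Qs" for i
  proof (cases "Suc i < length Qs")
    case True
    thus ?thesis using rel unfolding lanczos_relations_def by (auto simp: nth_append)
  next
    case False
    hence ij: "i = j - 1" "Suc i = length Qs" using i len by (auto simp: j_def)
    let ?T = "block_cols Qs \<union> set (cols (H * Q))"
    have T: "?T \<subseteq> carrier_vec n" using S set_cols_carrier[OF HQ] by auto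
    have "set (cols E) \<subseteq> vec_span n ?T" using E(3) vec_span_mono[OF T, of "block_cols Qs"] by auto
    hence "set (cols W) \<subseteq> vec_span n ?T"
      unfolding E(2) by (rule cols_diff_in_vec_span[OF HQ E(1) T vec_span_superset[OF T Un_upper2]])
    hence "set (cols N) \<subseteq> vec_span n ?T"
      unfolding C(2) by (rule cols_mult_left_in_vec_span[OF Wc C(1) T])
    thus ?thesis using ij Qj by (simp add: nth_append)
  qed
  show ?thesis
    unfolding lanczos_relations_def
    using orth' tri span1 span2 len by (auto simp: j_def)
qed

lemma lanczos_state_relations:
  assumes state: "lanczos_state n H D0 Qs Bs"
    and H: "H \<in> carrier_mat n n" "mat_adjoint H = H" and D0: "D0 \<in> carrier_mat n c"
  shows "lanczos_relations n H Qs Bs \<and> vec_span n (set (cols (hd Qs))) = vec_span n (set (cols D0))"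
  using state
proof induction
  case (start G R V)
  note svd = svd_truncation[OF D0 start refl]
  let ?N = "first_cols (mat_rank D0) G"
  obtain C where C: "C \<in> carrier_mat c (mat_rank D0)" "?N = D0 * C" using svd(5) by blast
  have "set (cols ?N) \<subseteq> vec_span n (set (cols D0))"
    using cols_mult_in_vec_span[OF D0 C(1)] C(2) by simp
  moreover have "set (cols D0) \<subseteq> vec_span n (set (cols ?N))"
    using cols_mult_in_vec_span[OF svd(1,3)] svd(4) by simp
  ultimately have "vec_span n (set (cols ?N)) = vec_span n (set (cols D0))"
    using vec_span_minimal set_cols_carrier[OF svd(1)] set_cols_carrier[OF D0] by blast
  thus ?case using svd(1,2) by (auto simp: lanczos_relations_def orthonormal_blocks_def)
next
  case (step Qs Bs W G R V r)
  hence rel: "lanczos_relations n H Qs Bs" by simp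
  obtain E where E: "E \<in> carrier_mat n (dim_col (last Qs))"
    "lanczos_residual H Qs Bs = H * last Qs - E"
    using residual_is_projection_error[OF rel H] by metis
  have W: "W \<in> carrier_mat n (dim_col (last Qs))"
    unfolding step.hyps(3) E(2) by (rule minus_carrier_mat[OF E(1)])
  note svd = svd_truncation[OF W step.hyps(4,5)]
  obtain C where C: "C \<in> carrier_mat (dim_col (last Qs)) r" "first_cols r G = W * C"
    using svd(5) by blast
  have "lanczos_relations n H (Qs @ [first_cols r G])
     (Bs @ [leading_block r R * mat_adjoint (first_cols r V)])"
    by (rule lanczos_relations_step[OF rel H step.hyps(3) svd(1-4) C])
  moreover have "Qs \<noteq> []" using rel by (simp add: lanczos_relations_def)
  ultimately show ?case using step.IH by simp
qed

lemma lanczos_state_prefix_size: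
  assumes "lanczos_state n H D0 Qs Bs" "1 \<le> k" "k < length Qs"
  shows "sum_list (take k (map dim_col Qs)) < n"
  using assms
proof induction
  case (step Qs Bs W G R V r)
  show ?case
  proof (cases "k = length Qs")
    case True
    thus ?thesis using step by simp
  next
    case False
    thus ?thesis using step by simp
  qed
qed simp

section \<open>Lanczos for the Hermitian part of a unitary matrix\<close>

lemma hermitian_part_carrier:
  "U \<in> carrier_mat n n \<Longrightarrow> hermitian_part U \<in> carrier_mat n n"
  by (simp add: hermitian_part_def)

lemma hermitian_part_adjoint:
  "U \<in> carrier_mat n n \<Longrightarrow> mat_adjoint (hermitian_part U) = hermitian_part U"
  unfolding hermitian_part_def by (rule eq_matI) auto

text \<open>
  For unitary \<open>U\<close> this is \<open>2 U\<^sub>H = U + U\<^sup>-\<^sup>1\<close>.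
\<close>

lemma hermitian_part_mult_vec:
  assumes "U \<in> carrier_mat n n" "v \<in> carrier_vec n"
  shows "hermitian_part U *\<^sub>v v = (1 / 2) \<cdot>\<^sub>v (U *\<^sub>v v + mat_adjoint U *\<^sub>v v)"
proof -
  have "(U + mat_adjoint U) *\<^sub>v v = U *\<^sub>v v + mat_adjoint U *\<^sub>v v"
    using assms by (intro add_mult_distrib_mat_vec) auto
  moreover have "hermitian_part U *\<^sub>v v = (1 / 2) \<cdot>\<^sub>v ((U + mat_adjoint U) *\<^sub>v v)"
    using assms unfolding hermitian_part_def
    by (intro eq_vecI) (auto simp: scalar_prod_def sum_distrib_left mult.assoc)
  ultimately show ?thesis by simp
qed

definition orbit :: "complex mat \<Rightarrow> complex vec \<Rightarrow> int \<Rightarrow> complex vec"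
  where "orbit U z k =
    (if 0 \<le> k then ((*\<^sub>v) U ^^ nat k) z else ((*\<^sub>v) (mat_adjoint U) ^^ nat (- k)) z)"

lemma orbit_in_carrier:
  assumes "U \<in> carrier_mat n n" "z \<in> carrier_vec n"
  shows "orbit U z k \<in> carrier_vec n"
proof -
  have pow: "((*\<^sub>v) M ^^ i) z \<in> carrier_vec n" if "M \<in> carrier_mat n n" for M :: "complex mat" and i
    by (induction i) (use assms(2) that in auto)
  show ?thesis using pow[OF assms(1)] pow[OF mat_adjoint_carrier[OF assms(1)]] by (simp add: orbit_def)
qed

lemma orbit_Suc:
  assumes "unitary_mat n U" "z \<in> carrier_vec n"
  shows "U *\<^sub>v orbit U z k = orbit U z (k + 1)"
proof (cases "0 \<le> k")
  case True
  thus ?thesis by (simp add: orbit_def nat_add_distrib)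
next
  case False
  have U: "U \<in> carrier_mat n n" "U * mat_adjoint U = 1\<^sub>m n" using assms(1) by (auto simp: unitary_mat_def)
  define w where "w = orbit U z (k + 1)"
  have w: "w \<in> carrier_vec n" unfolding w_def by (rule orbit_in_carrier[OF U(1) assms(2)])
  have "nat (- k) = Suc (nat (- (k + 1)))" using False by simp
  hence "orbit U z k = mat_adjoint U *\<^sub>v w"
    using False by (cases "k = -1") (auto simp: orbit_def w_def)
  moreover have "U *\<^sub>v (mat_adjoint U *\<^sub>v w) = (U * mat_adjoint U) *\<^sub>v w"
    using U w by (intro assoc_mult_mat_vec[symmetric]) auto
  ultimately show ?thesis using U w by (simp add: w_def)
qed

text \<open>
  The Krylov vectors are combinations of orbit vectors, because the span of the orbit is invariant
  under \<open>U\<^sub>H\<close>; if they span everything, so does the orbit.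
\<close>

lemma krylov_spanning_orbit:
  fixes U :: "complex mat"
  assumes U: "unitary_mat n U" and z: "z \<in> carrier_vec n"
    and span: "vec_span n
           ({(hermitian_part U ^\<^sub>m (j - 1)) *\<^sub>v z | j. j \<ge> 1} \<union>
            {(hermitian_part U ^\<^sub>m (j - 1)) *\<^sub>v (U *\<^sub>v z) | j. j \<ge> 1}) = carrier_vec n"
  shows "unitary_orbit n U (orbit U z)"
proof
  let ?u = "orbit U z" and ?H = "hermitian_part U"
  have Uc: "U \<in> carrier_mat n n" and UU: "mat_adjoint U * U = 1\<^sub>m n"
    using U by (auto simp: unitary_mat_def)
  note H = hermitian_part_carrier[OF Uc]
  show car: "?u k \<in> carrier_vec n" for k by (rule orbit_in_carrier[OF Uc z])
  show step: "U *\<^sub>v ?u k = ?u (k + 1)" for k by (rule orbit_Suc[OF U z])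
  have step_back: "mat_adjoint U *\<^sub>v ?u k = ?u (k - 1)" for k
  proof -
    have "mat_adjoint U *\<^sub>v ?u k = (mat_adjoint U * U) *\<^sub>v ?u (k - 1)"
      using step[of "k - 1"] assoc_mult_mat_vec[OF mat_adjoint_carrier[OF Uc] Uc car] by simp
    thus ?thesis using UU car by simp
  qed
  have S: "range ?u \<subseteq> carrier_vec n" using car by auto
  have Hu: "?H *\<^sub>v s \<in> vec_span n (range ?u)" if "s \<in> range ?u" for s
  proof -
    from that obtain k where k: "s = ?u k" by blast
    show ?thesis
      unfolding k hermitian_part_mult_vec[OF Uc car] step step_back
      by (intro vec_span_smult vec_span_add S vec_span_base) auto
  qed
  have pow: "(?H ^\<^sub>m i) *\<^sub>v v \<in> vec_span n (range ?u)" if "v \<in> vec_span n (range ?u)" for i v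
    using that
  proof (induction i arbitrary: v)
    case 0
    thus ?case using vec_span_carrier[OF S] H by simp
  next
    case (Suc i)
    have "(?H ^\<^sub>m Suc i) *\<^sub>v v = (?H ^\<^sub>m i) *\<^sub>v (?H *\<^sub>v v)"
      using vec_span_carrier[OF S Suc.prems] H assoc_mult_mat_vec[OF pow_carrier_mat[OF H] H]
      by simp
    thus ?case using Suc.IH mult_mat_vec_span[OF H S S Hu Suc.prems] by simp
  qed
  have "z = ?u 0" "U *\<^sub>v z = ?u 1" by (auto simp: orbit_def)
  hence "z \<in> vec_span n (range ?u)" "U *\<^sub>v z \<in> vec_span n (range ?u)"
    using vec_span_base[OF S] by auto
  hence "carrier_vec n \<subseteq> vec_span n (range ?u)"
    unfolding span[symmetric] by (intro vec_span_minimal[OF S]) (auto intro: pow)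
  thus "vec_span n (range ?u) = carrier_vec n" using vec_span_carrier[OF S] by blast
qed (rule U)

context unitary_orbit
begin

lemma hermitian_part_orbit:
  "hermitian_part U *\<^sub>v u k = (1 / 2) \<cdot>\<^sub>v (u (k + 1) + u (k - 1))"
  using hermitian_part_mult_vec[OF U_carrier orbit_carrier]
  by (simp add: orbit_step orbit_step_adjoint)

lemma orbit_forward: "u (k + 1) = 2 \<cdot>\<^sub>v (hermitian_part U *\<^sub>v u k) - u (k - 1)"
  and orbit_backward: "u (k - 1) = 2 \<cdot>\<^sub>v (hermitian_part U *\<^sub>v u k) - u (k + 1)"
proof -
  have [simp]: "dim_vec (u i) = n" for i using orbit_carrier[of i] by (rule carrier_vecD)
  show "u (k + 1) = 2 \<cdot>\<^sub>v (hermitian_part U *\<^sub>v u k) - u (k - 1)"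
    "u (k - 1) = 2 \<cdot>\<^sub>v (hermitian_part U *\<^sub>v u k) - u (k + 1)"
    unfolding hermitian_part_orbit by (auto intro!: eq_vecI simp: field_simps)
qed

text \<open>
  The two new vectors \<open>u\<^sub>k\<^sub>+\<^sub>1\<close> and \<open>u\<^sub>-\<^sub>k\<close> are obtained by solving \<open>2 U\<^sub>H u\<^sub>i = u\<^sub>i\<^sub>+\<^sub>1 + u\<^sub>i\<^sub>-\<^sub>1\<close> at the two
  ends of the window.
\<close>

lemma window_grows:
  assumes k: "1 \<le> k" and T: "T \<subseteq> carrier_vec n"
    and win: "\<And>i. 1 - int k \<le> i \<Longrightarrow> i \<le> int k \<Longrightarrow> u i \<in> vec_span n T"
    and Hwin: "\<And>i. 1 - int k \<le> i \<Longrightarrow> i \<le> int k \<Longrightarrow> hermitian_part U *\<^sub>v u i \<in> vec_span n T"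
  shows "u ` {1 - int (Suc k)..int (Suc k)} \<subseteq> vec_span n T"
proof -
  have "u (int k + 1) \<in> vec_span n T"
    unfolding orbit_forward using k by (intro vec_span_diff vec_span_smult T win Hwin) auto
  moreover have "u (- int k) \<in> vec_span n T"
  proof -
    have "u ((1 - int k) - 1) \<in> vec_span n T"
      unfolding orbit_backward using k by (intro vec_span_diff vec_span_smult T win Hwin) auto
    thus ?thesis by simp
  qed
  ultimately have "u i \<in> vec_span n T" if "- int k \<le> i" "i \<le> int k + 1" for i
  proof (cases "i = - int k \<or> i = int k + 1")
    case False
    thus ?thesis using that by (intro win) auto
  qed auto
  thus ?thesis by auto
qed

text \<open>
  Each Lanczos step enlarges the span by its image under \<open>U\<^sub>H\<close>, and this is exactly how a window turns
  into the next longer one.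
\<close>

lemma lanczos_prefix_span:
  assumes rel: "lanczos_relations n (hermitian_part U) Qs Bs"
    and start: "vec_span n (set (cols (hd Qs))) = vec_span n (u ` {0, 1})"
    and k: "1 \<le> k" "k \<le> length Qs"
  shows "vec_span n (block_cols (take k Qs)) = vec_span n (u ` {1 - int k..int k})"
  using k
proof (induction k rule: dec_induct)
  case base
  have "take 1 Qs = [hd Qs]" using base by (cases Qs) auto
  moreover have "{1 - int 1..int 1} = {0, 1}" by auto
  ultimately show ?case using start by simp
next
  case (step k)
  let ?H = "hermitian_part U" and ?S = "block_cols (take k Qs)"
  let ?T = "block_cols (take (Suc k) Qs)" and ?w = "\<lambda>k. u ` {1 - int k..int k}"
  have orth: "orthonormal_blocks n Qs" using rel by (simp add: lanczos_relations_def)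
  have H: "?H \<in> carrier_mat n n" by (rule hermitian_part_carrier[OF U_carrier])
  have S: "?S \<subseteq> carrier_vec n" and T: "?T \<subseteq> carrier_vec n"
    using orthonormal_blocksD(4)[OF orthonormal_blocks_take[OF orth]] by blast+
  have ST: "?S \<subseteq> ?T" using step.prems by (simp add: block_cols_take_Suc)
  have IH: "vec_span n ?S = vec_span n (?w k)" using step by simp
  have "?w (Suc k) \<subseteq> vec_span n ?T"
  proof (rule window_grows[OF step.hyps(1) T])
    fix i assume i: "1 - int k \<le> i" "i \<le> int k"
    have uS: "u i \<in> vec_span n ?S" unfolding IH using i by (intro vec_span_base) auto
    thus "u i \<in> vec_span n ?T" using vec_span_mono[OF T ST] by blast
    show "?H *\<^sub>v u i \<in> vec_span n ?T"
    proof (rule mult_mat_vec_span[OF H S T _ uS])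
      fix s assume "s \<in> ?S"
      then obtain j where j: "j < k" "j < length Qs" "s \<in> set (cols (Qs ! j))"
        by (rule block_cols_takeE)
      from j(3) obtain c where c: "c < dim_col (Qs ! j)" "s = col (Qs ! j) c" by (rule set_colsE)
      have "?H *\<^sub>v s = col (?H * Qs ! j) c"
        unfolding c(2) by (rule col_mult2[OF H orthonormal_blocksD(1)[OF orth j(2)] c(1), symmetric])
      also have "\<dots> \<in> set (cols (?H * Qs ! j))" using c(1) by (simp add: cols_def)
      also have "\<dots> \<subseteq> vec_span n (block_cols (take (Suc (Suc j)) Qs))"
        using rel j(1) step.prems unfolding lanczos_relations_def by simp
      also have "\<dots> \<subseteq> vec_span n ?T"
        using block_cols_take_subset[of "Suc (Suc j)" "take (Suc k) Qs"] j(1)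
        by (intro vec_span_mono[OF T]) (simp add: min_absorb1)
      finally show "?H *\<^sub>v s \<in> vec_span n ?T" .
    qed
  qed
  moreover have "?T \<subseteq> vec_span n (?w (Suc k))"
  proof -
    have mono: "vec_span n (?w k) \<subseteq> vec_span n (?w (Suc k))"
      by (intro vec_span_mono image_mono) auto
    have SW: "?S \<subseteq> vec_span n (?w (Suc k))" using vec_span_base[OF S] IH mono by blast
    obtain j where j: "k = Suc j" using step.hyps(1) by (cases k) auto
    have jl: "j < length Qs" using step.prems j by simp
    have "set (cols (?H * Qs ! j)) \<subseteq> vec_span n (?w (Suc k))"
    proof
      fix v assume "v \<in> set (cols (?H * Qs ! j))"
      then obtain c where c: "c < dim_col (Qs ! j)" "v = col (?H * Qs ! j) c"
        by (auto elim: set_colsE)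
      have v: "v = ?H *\<^sub>v col (Qs ! j) c"
        unfolding c(2) by (rule col_mult2[OF H orthonormal_blocksD(1)[OF orth jl] c(1)])
      have "col (Qs ! j) c \<in> ?S"
        using block_cols_take_nth[of j k Qs] j step.prems c(1) by (auto simp: cols_def)
      hence col: "col (Qs ! j) c \<in> vec_span n (?w k)" using vec_span_base[OF S] IH by blast
      show "v \<in> vec_span n (?w (Suc k))"
        unfolding v
      proof (rule mult_mat_vec_span[OF H orbit_subset orbit_subset _ col])
        fix s assume "s \<in> ?w k"
        then obtain i where "s = u i" and "1 - int k \<le> i" "i \<le> int k" by auto
        from this(2,3) show "?H *\<^sub>v s \<in> vec_span n (?w (Suc k))"
          unfolding \<open>s = u i\<close> hermitian_part_orbit
          by (intro vec_span_smult[OF orbit_subset vec_span_add[OF orbit_subset]]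
                vec_span_base[OF orbit_subset]) auto
      qed
    qed
    hence "vec_span n (?S \<union> set (cols (?H * Qs ! j))) \<subseteq> vec_span n (?w (Suc k))"
      using SW by (intro vec_span_minimal orbit_subset) auto
    moreover have "set (cols (Qs ! k)) \<subseteq> vec_span n (?S \<union> set (cols (?H * Qs ! j)))"
      using rel step.prems unfolding lanczos_relations_def j by simp
    ultimately show ?thesis
      using SW step.prems by (auto simp: block_cols_take_Suc)
  qed
  ultimately show ?case
    using vec_span_minimal[OF T] vec_span_minimal[OF orbit_subset] by blast
qed

text \<open>
  A zero residual means that \<open>U\<^sub>H\<close> leaves the span of the blocks invariant. This span is that of a
  window, which therefore contains its upper neighbour, so that it is invariant under \<open>U\<close> as well and
  is the whole space. Then the number of columns is already \<open>n\<close>.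
\<close>

lemma no_early_termination:
  assumes rel: "lanczos_relations n (hermitian_part U) Qs Bs"
    and blocks: "orbit_blocks n U u Qs"
    and small: "sum_list (map dim_col Qs) < n"
  shows "mat_rank (lanczos_residual (hermitian_part U) Qs Bs) \<noteq> 0"
proof
  let ?H = "hermitian_part U" and ?S = "block_cols Qs" and ?p = "length Qs"
  interpret orbit_blocks n U u Qs by (rule blocks)
  have ne: "Qs \<noteq> []" and orth: "orthonormal_blocks n Qs"
    using rel by (auto simp: lanczos_relations_def)
  have S: "?S \<subseteq> carrier_vec n" by (rule orthonormal_blocksD(4)[OF orth])
  have H: "?H \<in> carrier_mat n n" by (rule hermitian_part_carrier[OF U_carrier])
  have span: "vec_span n ?S = vec_span n (u ` {1 - int ?p..int ?p})"
    using prefix_span[of ?p] ne by (simp add: Suc_leI)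
  obtain E where E: "E \<in> carrier_mat n (dim_col (last Qs))"
      "lanczos_residual ?H Qs Bs = ?H * last Qs - E" "set (cols E) \<subseteq> vec_span n ?S"
    using residual_is_projection_error[OF rel H hermitian_part_adjoint[OF U_carrier]] by metis
  assume "mat_rank (lanczos_residual ?H Qs Bs) = 0"
  moreover have W: "lanczos_residual ?H Qs Bs \<in> carrier_mat n (dim_col (last Qs))"
    unfolding E(2) by (rule minus_carrier_mat[OF E(1)])
  ultimately have zero: "?H * last Qs - E = 0\<^sub>m n (dim_col (last Qs))"
    using rank_nonzero[OF W] E(2) by force
  have pl: "?p - 1 < ?p" and Ql: "Qs ! (?p - 1) = last Qs" using ne by (simp_all add: last_conv_nth)
  have Q: "last Qs \<in> carrier_mat n (dim_col (last Qs))"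
    using orthonormal_blocksD(1)[OF orth pl] unfolding Ql .
  have HQ: "?H * last Qs = E"
  proof (rule eq_matI)
    fix i j assume ij: "i < dim_row E" "j < dim_col E"
    hence "(?H * last Qs - E) $$ (i, j) = 0" unfolding zero using E(1) by auto
    thus "(?H * last Qs) $$ (i, j) = E $$ (i, j)" using ij by simp
  qed (use E(1) H in auto)
  have HS: "?H *\<^sub>v s \<in> vec_span n ?S" if "s \<in> ?S" for s
  proof -
    have "s \<in> block_cols (take ?p Qs)" using that by simp
    then obtain j where j: "j < ?p" "s \<in> set (cols (Qs ! j))" by (rule block_cols_takeE)
    from j(2) obtain c where c: "c < dim_col (Qs ! j)" "s = col (Qs ! j) c" by (rule set_colsE)
    have s: "?H *\<^sub>v s = col (?H * Qs ! j) c"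
      unfolding c(2) by (rule col_mult2[OF H orthonormal_blocksD(1)[OF orth j(1)] c(1), symmetric])
    have "?H *\<^sub>v s \<in> set (cols (?H * Qs ! j))" unfolding s using c(1) by (simp add: cols_def)
    moreover have "set (cols (?H * Qs ! j)) \<subseteq> vec_span n ?S"
    proof (cases "Suc j < ?p")
      case True
      hence "set (cols (?H * Qs ! j)) \<subseteq> vec_span n (block_cols (take (Suc (Suc j)) Qs))"
        using rel unfolding lanczos_relations_def by blast
      thus ?thesis using vec_span_mono[OF S block_cols_take_subset] by blast
    next
      case False
      hence "j = ?p - 1" using j(1) by simp
      thus ?thesis using HQ E(3) Ql by simp
    qed
    ultimately show ?thesis by blast
  qed
  have "u ` {1 - int (Suc ?p)..int (Suc ?p)} \<subseteq> vec_span n ?S"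
  proof (rule window_grows[OF _ S])
    show "1 \<le> ?p" using ne by (simp add: Suc_leI)
    fix i assume "1 - int ?p \<le> i" "i \<le> int ?p"
    thus u: "u i \<in> vec_span n ?S" unfolding span by (intro vec_span_base) auto
    show "?H *\<^sub>v u i \<in> vec_span n ?S" by (rule mult_mat_vec_span[OF H S S HS u])
  qed
  hence next_window: "u (i + 1) \<in> vec_span n ?S" if "1 - int ?p \<le> i" "i \<le> int ?p" for i
    using that by auto
  have US: "U *\<^sub>v s \<in> vec_span n ?S" if "s \<in> ?S" for s
  proof (rule mult_mat_vec_span[OF U_carrier orbit_subset S])
    show "s \<in> vec_span n (u ` {1 - int ?p..int ?p})"
      using vec_span_base[OF S that] span by simp
    fix w assume "w \<in> u ` {1 - int ?p..int ?p}"
    thus "U *\<^sub>v w \<in> vec_span n ?S" using next_window by (auto simp: orbit_step)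
  qed
  note indpt = orthonormal_blocks_independent[OF orth]
  have "1 - int ?p \<le> 1" "1 \<le> int ?p" using ne by (auto simp: Suc_leI)
  hence "u 1 \<in> vec_span n ?S" unfolding span by (intro vec_span_base) auto
  hence "vec_span n ?S = carrier_vec n"
    by (intro invariant_subspace_full[OF S finite_block_cols indpt(1) US])
  hence "card ?S = n" by (intro independent_spanning_card S finite_block_cols indpt(1))
  thus False using indpt(2) small by simp
qed

end

section \<open>Block sizes and rank-one blocks\<close>

text \<open>
  The increments of \<open>min (2 k) n\<close> are all \<open>2\<close>, except for a last one equal to \<open>1\<close> when \<open>n\<close> is odd.
\<close>

lemma block_sizes_from_prefixes:
  assumes n: "1 \<le> n" and total: "sum_list ds = n"
    and prefix: "\<And>k. 1 \<le> k \<Longrightarrow> k \<le> length ds \<Longrightarrow> sum_list (take k ds) = min (2 * k) n"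
    and proper: "\<And>k. 1 \<le> k \<Longrightarrow> k < length ds \<Longrightarrow> sum_list (take k ds) < n"
  shows "ds = replicate (n div 2) 2 @ (if odd n then [1] else [])"
proof -
  have pos: "1 \<le> length ds" using n total by (cases ds) auto
  have "min (2 * length ds) n = n" using prefix[OF pos le_refl] total by simp
  moreover have "2 * (length ds - 1) < n"
  proof (cases "length ds = 1")
    case False
    hence "1 \<le> length ds - 1" using pos by linarith
    moreover have "length ds - 1 < length ds" using pos by simp
    ultimately show ?thesis using prefix[of "length ds - 1"] proper[of "length ds - 1"] by simp
  qed (use n in simp)
  ultimately have len: "length ds = (n + 1) div 2" using pos by linarith
  show ?thesis
  proof (rule nth_equalityI)
    show "length ds = length (replicate (n div 2) 2 @ (if odd n then [1] else []) :: nat list)"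
      unfolding len by (auto elim!: oddE evenE)
    fix i assume i: "i < length ds"
    have "sum_list (take i ds) = min (2 * i) n" using prefix[of i] i by (cases i) auto
    moreover have "sum_list (take (Suc i) ds) = min (2 * Suc i) n" using prefix[of "Suc i"] i by simp
    ultimately have "ds ! i = min (2 * Suc i) n - min (2 * i) n"
      using i by (simp add: take_Suc_conv_app_nth)
    thus "ds ! i = (replicate (n div 2) 2 @ (if odd n then [1] else [])) ! i"
      using i len by (auto simp: nth_append min_def elim!: oddE evenE, presburger)
  qed
qed

theorem corollary1:
  fixes n :: nat and U :: "complex mat" and z :: "complex vec" and out :: lanczos_outcome
  assumes "n \<ge> 1"
    and "unitary_mat n U"
    and "z \<in> carrier_vec n"
    and "vec_span n
           ({(hermitian_part U ^\<^sub>m (j - 1)) *\<^sub>v z | j. j \<ge> 1} \<union>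
            {(hermitian_part U ^\<^sub>m (j - 1)) *\<^sub>v (U *\<^sub>v z) | j. j \<ge> 1}) = carrier_vec n"
    and "block_lanczos n (hermitian_part U) (mat_of_cols n [z, U *\<^sub>v z]) out"
  shows "\<exists>Qs. out = Returned Qs \<and>
    (let p = length Qs;
         sz = map dim_col Qs;
         Q = concat_cols n Qs;
         T = mat_adjoint Q * U * Q
     in unitary_mat n Q \<and>
        sz = replicate (n div 2) 2 @ (if odd n then [1] else []) \<and>
        block_tridiagonal sz T \<and>
        (\<forall>k\<in>{1..p - 1}.
           (let s = (if odd n \<and> k = p - 1 then 1 else 2);
                B_sub = mat_block sz T (k + 1) k;
                B_super = mat_block sz T k (k + 1)
            in B_sub \<in> carrier_mat s 2 \<and> mat_rank B_sub = 1 \<and>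
               B_super \<in> carrier_mat 2 s \<and> mat_rank B_super = 1)))"
proof -
  let ?u = "orbit U z" and ?H = "hermitian_part U" and ?D0 = "mat_of_cols n [z, U *\<^sub>v z]"
  interpret unitary_orbit n U ?u by (rule krylov_spanning_orbit[OF assms(2-4)])
  note H = hermitian_part_carrier[OF U_carrier] hermitian_part_adjoint[OF U_carrier]
  have uz: "z = ?u 0" "U *\<^sub>v z = ?u 1" by (auto simp: orbit_def)
  have D0: "?D0 \<in> carrier_mat n 2" by (auto intro: carrier_matI)
  have "set (cols ?D0) = ?u ` {0, 1}" using uz orbit_carrier[of 0] orbit_carrier[of 1] by simp
  hence start: "vec_span n (set (cols ?D0)) = vec_span n (?u ` {0, 1})" by simp
  have state: "lanczos_relations n ?H Qs Bs \<and> orbit_blocks n U ?u Qs"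
    if "lanczos_state n ?H ?D0 Qs Bs" for Qs Bs
  proof -
    have rel: "lanczos_relations n ?H Qs Bs"
      and hd: "vec_span n (set (cols (hd Qs))) = vec_span n (?u ` {0, 1})"
      using lanczos_state_relations[OF that H D0] start by auto
    have "orbit_blocks n U ?u Qs"
      using rel lanczos_prefix_span[OF rel hd]
      by unfold_locales (auto simp: lanczos_relations_def)
    thus ?thesis using rel by blast
  qed
  from assms(5) show ?thesis
  proof cases
    case (early Qs Bs)
    thus ?thesis using no_early_termination state by blast
  next
    case (returned Qs Bs)
    interpret orbit_blocks n U ?u Qs using state[OF returned(2)] by blast
    let ?ds = "map dim_col Qs" and ?P = "concat_cols n Qs"
    have rows: "\<forall>Q\<in>set Qs. dim_row Q = n" using orthonormal by (simp add: orthonormal_blocks_def)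
    have sz: "?ds = replicate (n div 2) 2 @ (if odd n then [1] else [])"
      using lanczos_state_prefix_size[OF returned(2)] prefix_size assms(1) returned(3)
      by (intro block_sizes_from_prefixes) auto
    have len: "length Qs = n div 2 + (if odd n then 1 else 0)"
      using arg_cong[OF sz, of length] by simp
    have dim: "dim_col (Qs ! i) = (if odd n \<and> i = length Qs - 1 then 1 else 2)" if "i < length Qs" for i
    proof -
      have "dim_col (Qs ! i) = ?ds ! i" using that by simp
      also have "\<dots> = (if odd n \<and> i = length Qs - 1 then 1 else 2)"
        unfolding sz using that len by (auto simp: nth_append)
      finally show ?thesis .
    qed
    have blocks: "(let s = (if odd n \<and> k = length Qs - 1 then 1 else 2);
                B_sub = mat_block ?ds (mat_adjoint ?P * U * ?P) (k + 1) k;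
                B_super = mat_block ?ds (mat_adjoint ?P * U * ?P) k (k + 1)
            in B_sub \<in> carrier_mat s 2 \<and> mat_rank B_sub = 1 \<and>
               B_super \<in> carrier_mat 2 s \<and> mat_rank B_super = 1)"
      if k: "k \<in> {1..length Qs - 1}" for k
    proof -
      obtain i where i: "k = Suc i" using k by (cases k) auto
      have il: "i < length Qs" "Suc i < length Qs" using k i by auto
      have small: "sum_list (take (Suc i) ?ds) < n"
        using lanczos_state_prefix_size[OF returned(2), of "Suc i"] il by simp
      let ?s = "if odd n \<and> k = length Qs - 1 then 1 else 2"
      have cols: "dim_col (Qs ! i) = 2" "dim_col (Qs ! Suc i) = ?s" using dim il i by auto
      have Qi: "Qs ! i \<in> carrier_mat n 2" using block_carrier[OF il(1)] unfolding cols .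
      have Qk: "Qs ! Suc i \<in> carrier_mat n ?s" using block_carrier[OF il(2)] unfolding cols .
      have sub: "mat_block ?ds (mat_adjoint ?P * U * ?P) (k + 1) k = mat_adjoint (Qs ! Suc i) * U * Qs ! i"
        using mat_block_concat_cols[OF rows U_carrier il(2,1)] i by simp
      have super: "mat_block ?ds (mat_adjoint ?P * U * ?P) k (k + 1) = mat_adjoint (Qs ! i) * U * Qs ! Suc i"
        using mat_block_concat_cols[OF rows U_carrier il] i by simp
      have "mat_adjoint (Qs ! Suc i) * U * Qs ! i \<in> carrier_mat ?s 2"
        "mat_adjoint (Qs ! i) * U * Qs ! Suc i \<in> carrier_mat 2 ?s"
        by (intro mult_carrier_mat[of _ _ n] mat_adjoint_carrier Qi Qk U_carrier)+
      thus ?thesis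
        unfolding Let_def sub super
        using subdiagonal_rank_one(1)[OF il(2) small] superdiagonal_rank_one[OF il(2) small] by blast
    qed
    show ?thesis
      using returned(1) sz blocks unitary_concat_cols[OF returned(3)]
        block_tridiagonal_compression[OF returned(3)]
      unfolding Let_def by blast
  qed
qed

end
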